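(* Let $(E,\mathcal{B},m)$ be a $\sigma$-finite measure space. Let $D_0$ be a dense linear subspace of $L^2(m)$ and let $L_0\colon D_0\to L^2(m)$ be a symmetric linear operator which is upper bounded, i.e. $\sup_{u\in D_0\setminus\{0\}}(L_0u,u)_2\,\|u\|_2^{-2}<\infty$. Assume that for every $T\in(0,\infty)$ the linear span of $$\{\, f'\otimes\varphi+f\otimes L_0\varphi \;:\; \varphi\in D_0,\ f\in C^1([0,T];\mathbb{R}),\ f(T)=0 \,\}$$ is dense in $L^{2}([0,T]\times E,\,dt\otimes m)$. Then the set $\mathcal{M}_{sym}(L_0,D_0)$ consists of exactly one element.
   Context: All $L^p$-spaces are real; $(\cdot,\cdot)_2$ and $\|\cdot\|_2$ are the inner product and norm of $L^2(m)$. For $f\colon[0,T]\to\mathbb{R}$ and $\varphi\colon E\to\mathbb{R}$ put $(f\otimes\varphi)(t,x)=f(t)\varphi(x)$; thus $f'\otimes\varphi+f\otimes L_0\varphi=(\frac{\partial}{\partial s}+L_0)(f\otimes\varphi)$. A linear operator $L\colon D(L)\subset L^2(m)\to L^2(m)$ is called a generator on $L^2(m)$ if it is the generator of a strongly continuous semigroup $(e^{tL})_{t\ge0}$ of everywhere defined continuous linear operators on $L^2(m)$. $L_1\subset L_2$ means that the graph of $L_1$ is contained in the graph of $L_2$; $L$ is symmetric if $L\subset L^*$. $\mathcal{M}_{sym}(L_0,D_0)$ is the set of all linear operators $L\colon D(L)\subset L^2(m)\to L^2(m)$ such that $L_0\subset L$, $L$ is a generator on $L^2(m)$, and $L$ is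 symmetric. *)

theory Defs
  imports "HOL-Analysis.Analysis"
begin

definition sq_integrable :: "'a measure \<Rightarrow> ('a \<Rightarrow> real) set" where
  "sq_integrable M = {f \<in> borel_measurable M. integrable M (\<lambda>x. (f x)\<^sup>2)}"

definition L2_rel :: "'a measure \<Rightarrow> (('a \<Rightarrow> real) \<times> ('a \<Rightarrow> real)) set" where
  "L2_rel M = {(f, g). f \<in> sq_integrable M \<and> g \<in> sq_integrable M \<and> (AE x in M. f x = g x)}"

type_synonym 'a l2 = "('a \<Rightarrow> real) set"

definition L2 :: "'a measure \<Rightarrow> 'a l2 set" where
  "L2 M = sq_integrable M // L2_rel M"

definition L2_class :: "'a measure \<Rightarrow> ('a \<Rightarrow> real) \<Rightarrow> 'a l2" where
  "L2_class M f = L2_rel M `` {f}"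

text \<open>
  The operations below are computed on an arbitrarily chosen representative; on elements of
  \<^const>\<open>L2\<close> the results do not depend on this choice.
\<close>

definition L2_rep :: "'a l2 \<Rightarrow> 'a \<Rightarrow> real" where
  "L2_rep u = (SOME f. f \<in> u)"

definition L2_zero :: "'a measure \<Rightarrow> 'a l2" where
  "L2_zero M = L2_class M (\<lambda>x. 0)"

definition L2_add :: "'a measure \<Rightarrow> 'a l2 \<Rightarrow> 'a l2 \<Rightarrow> 'a l2" where
  "L2_add M u v = L2_class M (\<lambda>x. L2_rep u x + L2_rep v x)"

definition L2_diff :: "'a measure \<Rightarrow> 'a l2 \<Rightarrow> 'a l2 \<Rightarrow> 'a l2" where
  "L2_diff M u v = L2_class M (\<lambda>x. L2_rep u x - L2_rep v x)"

definition L2_scale :: "'a measure \<Rightarrow> real \<Rightarrow> 'a l2 \<Rightarrow> 'a l2" where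
  "L2_scale M c u = L2_class M (\<lambda>x. c * L2_rep u x)"

definition L2_inner :: "'a measure \<Rightarrow> 'a l2 \<Rightarrow> 'a l2 \<Rightarrow> real" where
  "L2_inner M u v = (\<integral>x. L2_rep u x * L2_rep v x \<partial>M)"

definition L2_norm :: "'a measure \<Rightarrow> 'a l2 \<Rightarrow> real" where
  "L2_norm M u = sqrt (L2_inner M u u)"

definition L2_dist :: "'a measure \<Rightarrow> 'a l2 \<Rightarrow> 'a l2 \<Rightarrow> real" where
  "L2_dist M u v = L2_norm M (L2_diff M u v)"

definition L2_subspace :: "'a measure \<Rightarrow> 'a l2 set \<Rightarrow> bool" where
  "L2_subspace M V \<longleftrightarrow> V \<subseteq> L2 M \<and> L2_zero M \<in> V \<and>
     (\<forall>u\<in>V. \<forall>v\<in>V. L2_add M u v \<in> V) \<and> (\<forall>c. \<forall>u\<in>V. L2_scale M c u \<in> V)"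

definition L2_span :: "'a measure \<Rightarrow> 'a l2 set \<Rightarrow> 'a l2 set" where
  "L2_span M S = L2_subspace M hull S"

definition L2_dense :: "'a measure \<Rightarrow> 'a l2 set \<Rightarrow> bool" where
  "L2_dense M S \<longleftrightarrow> S \<subseteq> L2 M \<and> (\<forall>u\<in>L2 M. \<forall>e>0. \<exists>v\<in>S. L2_dist M u v < e)"

text \<open>
  An operator is a partial map \<open>L\<close>: its domain \<open>D(L)\<close> is \<open>dom L\<close>, its value at
  \<open>u \<in> dom L\<close> is \<open>the (L u)\<close>, and its graph is \<open>Map.graph L\<close>.
\<close>

type_synonym 'a l2_op = "'a l2 \<rightharpoonup> 'a l2"

definition L2_linear_operator :: "'a measure \<Rightarrow> 'a l2_op \<Rightarrow> bool" where
  "L2_linear_operator M L \<longleftrightarrow> L2_subspace M (dom L) \<and> ran L \<subseteq> L2 M \<and>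
     (\<forall>u\<in>dom L. \<forall>v\<in>dom L. the (L (L2_add M u v)) = L2_add M (the (L u)) (the (L v))) \<and>
     (\<forall>c. \<forall>u\<in>dom L. the (L (L2_scale M c u)) = L2_scale M c (the (L u)))"

text \<open>
  For densely defined \<open>L\<close> the following relation is single-valued and is the graph of the
  adjoint operator \<open>L\<^sup>*\<close>.
\<close>

definition L2_adjoint_graph :: "'a measure \<Rightarrow> 'a l2_op \<Rightarrow> ('a l2 \<times> 'a l2) set" where
  "L2_adjoint_graph M L = {(v, w). v \<in> L2 M \<and> w \<in> L2 M \<and>
     (\<forall>u\<in>dom L. L2_inner M (the (L u)) v = L2_inner M u w)}"

definition L2_symmetric :: "'a measure \<Rightarrow> 'a l2_op \<Rightarrow> bool" where
  "L2_symmetric M L \<longleftrightarrow> Map.graph L \<subseteq> L2_adjoint_graph M L"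

definition L2_upper_bounded :: "'a measure \<Rightarrow> 'a l2_op \<Rightarrow> bool" where
  "L2_upper_bounded M L \<longleftrightarrow>
     bdd_above ((\<lambda>u. L2_inner M (the (L u)) u / (L2_norm M u)\<^sup>2) ` (dom L - {L2_zero M}))"

definition L2_continuous_linear :: "'a measure \<Rightarrow> ('a l2 \<Rightarrow> 'a l2) \<Rightarrow> bool" where
  "L2_continuous_linear M A \<longleftrightarrow> (\<forall>u\<in>L2 M. A u \<in> L2 M) \<and>
     (\<forall>u\<in>L2 M. \<forall>v\<in>L2 M. A (L2_add M u v) = L2_add M (A u) (A v)) \<and>
     (\<forall>c. \<forall>u\<in>L2 M. A (L2_scale M c u) = L2_scale M c (A u)) \<and>
     (\<forall>u\<in>L2 M. \<forall>e>0. \<exists>d>0. \<forall>v\<in>L2 M. L2_dist M v u < d \<longrightarrow> L2_dist M (A v) (A u) < e)"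

definition L2_C0_semigroup :: "'a measure \<Rightarrow> (real \<Rightarrow> 'a l2 \<Rightarrow> 'a l2) \<Rightarrow> bool" where
  "L2_C0_semigroup M S \<longleftrightarrow>
     (\<forall>t\<ge>0. L2_continuous_linear M (S t)) \<and>
     (\<forall>u\<in>L2 M. S 0 u = u) \<and>
     (\<forall>s\<ge>0. \<forall>t\<ge>0. \<forall>u\<in>L2 M. S (s + t) u = S s (S t u)) \<and>
     (\<forall>u\<in>L2 M. \<forall>t\<ge>0. ((\<lambda>s. L2_dist M (S s u) (S t u)) \<longlongrightarrow> 0) (at t within {0..}))"

definition L2_generator_of :: "'a measure \<Rightarrow> (real \<Rightarrow> 'a l2 \<Rightarrow> 'a l2) \<Rightarrow> 'a l2_op \<Rightarrow> bool" where
  "L2_generator_of M S L \<longleftrightarrow>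
     (\<forall>u v. L u = Some v \<longleftrightarrow> u \<in> L2 M \<and> v \<in> L2 M \<and>
        ((\<lambda>t. L2_dist M (L2_scale M (1 / t) (L2_diff M (S t u) u)) v) \<longlongrightarrow> 0) (at_right 0))"

definition L2_generator :: "'a measure \<Rightarrow> 'a l2_op \<Rightarrow> bool" where
  "L2_generator M L \<longleftrightarrow> (\<exists>S. L2_C0_semigroup M S \<and> L2_generator_of M S L)"

text \<open>The domain \<open>D\<^sub>0\<close> is carried by the partial map \<open>L\<^sub>0\<close> as \<open>dom L\<^sub>0\<close>.\<close>

definition M_sym :: "'a measure \<Rightarrow> 'a l2_op \<Rightarrow> 'a l2_op set" where
  "M_sym M L0 = {L. L2_linear_operator M L \<and> Map.graph L0 \<subseteq> Map.graph L \<and>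
     L2_generator M L \<and> L2_symmetric M L}"

definition spacetime :: "real \<Rightarrow> 'a measure \<Rightarrow> (real \<times> 'a) measure" where
  "spacetime T M = restrict_space lborel {0..T} \<Otimes>\<^sub>M M"

definition L2_tensor :: "real \<Rightarrow> 'a measure \<Rightarrow> (real \<Rightarrow> real) \<Rightarrow> 'a l2 \<Rightarrow> (real \<times> 'a) l2" where
  "L2_tensor T M f u = L2_class (spacetime T M) (\<lambda>(t, x). f t * L2_rep u x)"

text \<open>
  \<open>f \<in> C\<^sup>1([0,T])\<close> with derivative \<open>f'\<close>, one-sided at the endpoints; the values of
  \<open>f\<close> and \<open>f'\<close> outside \<open>[0,T]\<close> are irrelevant.
\<close>

definition C1_with_deriv :: "real \<Rightarrow> (real \<Rightarrow> real) \<Rightarrow> (real \<Rightarrow> real) \<Rightarrow> bool" where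
  "C1_with_deriv T f f' \<longleftrightarrow>
     (\<forall>t\<in>{0..T}. (f has_real_derivative f' t) (at t within {0..T})) \<and> continuous_on {0..T} f'"

definition spacetime_image :: "real \<Rightarrow> 'a measure \<Rightarrow> 'a l2_op \<Rightarrow> (real \<times> 'a) l2 set" where
  "spacetime_image T M L0 =
     {L2_add (spacetime T M) (L2_tensor T M f' \<phi>) (L2_tensor T M f (the (L0 \<phi>))) | f f' \<phi>.
        \<phi> \<in> dom L0 \<and> C1_with_deriv T f f' \<and> f T = 0}"

end

theory Submission
  imports Defs
begin

text \<open>
  Applying the density hypothesis to \<open>- 1 \<otimes> L\<^sub>0 u\<close> and reversing time yields, for every \<open>u \<in> D\<^sub>0\<close>,
  \<open>C\<^sup>1\<close> curves \<open>z\<close> in \<open>D\<^sub>0\<close> with \<open>z 0 = u\<close> whose residual \<open>z' - L\<^sub>0 z\<close> is arbitrarily small in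
  \<open>L\<^sup>2\<close>. Upper boundedness and Gronwall's inequality make such approximate solutions converge
  uniformly in time, and their limits form a semigroup. It is symmetric because
  \<open>d/ds (z (t - s), y s)\<close> only involves the residuals of \<open>z\<close> and \<open>y\<close>, and the same computation
  shows that its generator extends \<open>L\<^sub>0\<close>; no Friedrichs extension is needed. If \<open>S\<close> is the semigroup
  of any member of \<open>\<M>\<^sub>s\<^sub>y\<^sub>m\<close> and \<open>y\<close> an approximate solution starting in \<open>v \<in> D\<^sub>0\<close>, differentiating
  \<open>(S s u, y (t - s))\<close> shows that \<open>(S t u, v)\<close> is the limit of \<open>(u, y t)\<close>, which does not depend
  on \<open>S\<close>.
\<close>

section \<open>Right derivatives and integrals of curves\<close>

text \<open>Subtracting the constant curve \<open>u\<close> from a solution of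
  \<open>z' = L0 z\<close> leaves a curve with zero initial value that solves the equation with the
  extra term \<open>L0 u\<close>. Reversed in time it has zero terminal value, which is the
  condition \<open>f T = 0\<close> of the hypothesis; so a single target function per
  \<open>u\<close> has to be approximated. Residuals are small only in square mean over time. That
  is enough, because they enter in two ways only: through their integrated squares in the energy
  estimate, and through integrated pairings with curves bounded uniformly in \<open>n\<close>. A
  semigroup orbit is known to be differentiable only from the right, and an unknown symmetric
  generator \<open>L\<close> extending \<open>L0\<close> can be computed only against
  \<open>D0\<close>, where \<open>(L x, v) = (x, L0 v)\<close>. Hence the calculus of right
  derivatives and the weak form of the equation. L2 of a measure is a set of classes and not a type,
  so the abstract argument is carried out on a complete subspace \<open>H\<close> of an inner
  product space.\<close>

lemma right_derivative_zero_imp_eq: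
  fixes f :: "real \<Rightarrow> real"
  assumes "a \<le> b" and cont: "continuous_on {a..b} f"
    and deriv: "\<And>t. a \<le> t \<Longrightarrow> t < b \<Longrightarrow> (f has_real_derivative 0) (at_right t)"
  shows "f b = f a"
proof -
  have bound: "\<bar>f b - f a\<bar> \<le> e * (b - a)" if "e > 0" for e
  proof (rule ccontr)
    assume neg: "\<not> \<bar>f b - f a\<bar> \<le> e * (b - a)"
    \<comment> \<open>The slope \<open>e\<close> leaves room for a first-exit argument: at the
      infimum \<open>c\<close> of the times where the bound fails it still holds by continuity, and
      the zero right derivative carries it beyond \<open>c\<close>.\<close>
    define g where "g t = \<bar>f t - f a\<bar> - e * (t - a)" for t
    define B where "B = {t \<in> {a..b}. g t > 0}"
    define c where "c = Inf B"
    have gcont: "continuous_on {a..b} g"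
      unfolding g_def by (intro continuous_intros cont)
    have "b \<in> B" using neg \<open>a \<le> b\<close> by (auto simp: B_def g_def)
    have bdd: "bdd_below B" by (auto simp: B_def bdd_below_def)
    have cab: "a \<le> c" "c \<le> b"
      unfolding c_def using \<open>b \<in> B\<close> bdd by (auto simp: B_def intro!: cInf_greatest cInf_lower)
    have below: "g s \<le> 0" if "a \<le> s" "s < c" for s
    proof (rule ccontr)
      assume "\<not> g s \<le> 0"
      then have "s \<in> B" using that cab by (auto simp: B_def)
      then have "c \<le> s" unfolding c_def by (rule cInf_lower[OF _ bdd])
      then show False using that by simp
    qed
    have gc: "g c \<le> 0"
    proof (cases "a = c")
      case True
      then show ?thesis by (simp add: g_def)
    next
      case False
      then have "a < c" using cab by simp
      have "continuous_on {a..c} g" using gcont cab by (auto intro: continuous_on_subset)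
      then have lim: "(g \<longlongrightarrow> g c) (at_left c)"
        using \<open>a < c\<close> by (auto simp: continuous_on_Icc_at_leftD)
      have "eventually (\<lambda>s. g s \<le> 0) (at_left c)"
        using eventually_at_left_real[OF \<open>a < c\<close>] by eventually_elim (use below in auto)
      then show ?thesis using lim tendsto_upperbound trivial_limit_at_left_real by blast
    qed
    then have "c \<noteq> b" using \<open>b \<in> B\<close> by (auto simp: B_def)
    then have "c < b" using cab by simp
    from deriv[OF cab(1) this] have "((\<lambda>s. (f s - f c) / (s - c)) \<longlongrightarrow> 0) (at_right c)"
      by (simp add: has_field_derivative_iff)
    then have "eventually (\<lambda>s. \<bar>(f s - f c) / (s - c)\<bar> < e) (at_right c)"
      using \<open>e > 0\<close> by (auto dest!: tendstoD simp: dist_real_def)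
    moreover have "eventually (\<lambda>s. c < s) (at_right c)" by (simp add: eventually_at_right_less)
    ultimately have "eventually (\<lambda>s. g s \<le> 0) (at_right c)"
    proof eventually_elim
      case (elim s)
      then have "\<bar>f s - f c\<bar> \<le> e * (s - c)" by (simp add: field_simps abs_divide)
      then show ?case using gc by (simp add: g_def algebra_simps)
    qed
    then obtain d where d: "d > c" "\<And>s. c < s \<Longrightarrow> s < d \<Longrightarrow> g s \<le> 0"
      by (auto simp: eventually_at_right_field)
    have "min d b \<le> c" unfolding c_def
    proof (rule cInf_greatest)
      show "B \<noteq> {}" using \<open>b \<in> B\<close> by auto
    next
      fix s assume s: "s \<in> B"
      show "min d (b::real) \<le> s"
      proof (rule ccontr)
        assume "\<not> min d b \<le> s"
        then have "s < d" by simp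
        then show False using d(2)[of s] gc below[of s] s
          by (cases "s < c"; cases "s = c") (auto simp: B_def)
      qed
    qed
    then show False using d \<open>c < b\<close> by auto
  qed
  have "\<bar>f b - f a\<bar> \<le> 0"
  proof (rule field_le_epsilon)
    fix e :: real assume "e > 0"
    \<comment> \<open>The summand 1 keeps the slope positive when \<open>a = b\<close>.\<close>
    have "\<bar>f b - f a\<bar> \<le> e / (b - a + 1) * (b - a)"
      using \<open>e > 0\<close> \<open>a \<le> b\<close> by (intro bound) auto
    also have "\<dots> \<le> e" using \<open>e > 0\<close> \<open>a \<le> b\<close> by (simp add: field_simps)
    finally show "\<bar>f b - f a\<bar> \<le> 0 + e" by simp
  qed
  then show ?thesis by simp
qed

lemma has_vector_derivative_at_right:
  assumes "(f has_vector_derivative d) (at t within {a..b})" "a \<le> t" "t < (b::real)"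
  shows "(f has_vector_derivative d) (at_right t)"
proof -
  have "(f has_vector_derivative d) (at t within {t..b})"
    using assms by (auto intro: has_vector_derivative_within_subset)
  then show ?thesis using assms by (simp add: at_within_Icc_at_right)
qed

lemma has_vector_derivative_at_rightI:
  fixes f :: "real \<Rightarrow> 'h::real_normed_vector"
  assumes "((\<lambda>h. (1 / h) *\<^sub>R (f (s + h) - f s)) \<longlongrightarrow> d) (at_right 0)"
  shows "(f has_vector_derivative d) (at_right s)"
proof -
  have "((\<lambda>y. (1 / (y - s)) *\<^sub>R (f y - f s)) \<longlongrightarrow> d) (at_right s)"
    using assms by (subst filterlim_at_right_to_0) (simp add: add.commute)
  then have "((\<lambda>y. (1 / (y - s)) *\<^sub>R (f y - f s) - d) \<longlongrightarrow> 0) (at_right s)"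
    by (simp add: LIM_zero)
  moreover have "eventually (\<lambda>y. (1 / (y - s)) *\<^sub>R (f y - f s) - d
      = (1 / norm (y - s)) *\<^sub>R (f y - (f s + (y - s) *\<^sub>R d))) (at_right s)"
    using eventually_at_right_less[of s]
    by eventually_elim (simp add: scaleR_diff_right scaleR_add_right diff_diff_eq)
  ultimately have "((\<lambda>y. (1 / norm (y - s)) *\<^sub>R (f y - (f s + (y - s) *\<^sub>R d))) \<longlongrightarrow> 0) (at_right s)"
    by (rule Lim_transform_eventually)
  then show ?thesis
    by (simp add: has_vector_derivative_def has_derivative_within bounded_linear_scaleR_left)
qed

text \<open>Subtracting the indefinite integral of \<open>q\<close> leaves a continuous function
  with zero right derivative.\<close>

lemma fundamental_theorem_of_calculus_right:
  fixes f q :: "real \<Rightarrow> real"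
  assumes "a \<le> b" "continuous_on {a..b} f" "continuous_on {a..b} q"
    and deriv: "\<And>t. a \<le> t \<Longrightarrow> t < b \<Longrightarrow> (f has_real_derivative q t) (at_right t)"
  shows "f b - f a = integral {a..b} q"
proof -
  define h where "h t = f t - integral {a..t} q" for t
  have dint: "((\<lambda>x. integral {a..x} q) has_real_derivative q t) (at t within {a..b})"
    if "t \<in> {a..b}" for t
    using integral_has_real_derivative[OF assms(3) that] .
  have "h b = h a"
  proof (rule right_derivative_zero_imp_eq[OF \<open>a \<le> b\<close>])
    show "continuous_on {a..b} h" unfolding h_def
      using assms by (intro continuous_intros indefinite_integral_continuous_1 integrable_continuous_real)
  next
    fix t assume t: "a \<le> t" "t < b"
    have "((\<lambda>x. integral {a..x} q) has_real_derivative q t) (at_right t)"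
      using dint[of t] t has_vector_derivative_at_right[of _ "q t" t a b]
      by (auto simp: has_real_derivative_iff_has_vector_derivative)
    from DERIV_diff[OF deriv[OF t] this] show "(h has_real_derivative 0) (at_right t)"
      by (simp add: h_def[abs_def])
  qed
  then show ?thesis by (simp add: h_def)
qed

text \<open>Parallelogram law: the integrand on the right exceeds the one on the left by the square
  of \<open>norm (r t - s t)\<close>.\<close>

lemma integral_power2_norm_add_le:
  fixes r s :: "real \<Rightarrow> 'h::real_inner"
  assumes "continuous_on {0..T} r" "continuous_on {0..T} s"
  shows "integral {0..T} (\<lambda>t. (norm (r t + s t))\<^sup>2)
    \<le> 2 * integral {0..T} (\<lambda>t. (norm (r t))\<^sup>2) + 2 * integral {0..T} (\<lambda>t. (norm (s t))\<^sup>2)"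
proof -
  have le: "(norm (r t + s t))\<^sup>2 \<le> 2 * (norm (r t))\<^sup>2 + 2 * (norm (s t))\<^sup>2" for t
    using zero_le_power2[of "norm (r t - s t)"]
    by (simp add: power2_norm_eq_inner inner_simps inner_commute)
  have "integral {0..T} (\<lambda>t. (norm (r t + s t))\<^sup>2)
    \<le> integral {0..T} (\<lambda>t. 2 * (norm (r t))\<^sup>2 + 2 * (norm (s t))\<^sup>2)"
    by (intro integral_le integrable_continuous_real continuous_intros assms le)
  also have "\<dots> = 2 * integral {0..T} (\<lambda>t. (norm (r t))\<^sup>2) + 2 * integral {0..T} (\<lambda>t. (norm (s t))\<^sup>2)"
    by (subst integral_add) (auto intro!: integrable_continuous_real continuous_intros assms)
  finally show ?thesis .
qed

text \<open>A weighted Young inequality takes the place of Cauchy-Schwarz for integrals. The weight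
  \<open>d\<close> is fixed first, so that the constant part of the bound is small for all
  \<open>n\<close>; then the residual part tends to zero.\<close>

lemma integral_pairing_tendsto_zero:
  fixes x r :: "nat \<Rightarrow> real \<Rightarrow> 'h::real_inner"
  assumes "0 \<le> t"
    and x: "\<And>n. continuous_on {0..t} (x n)" "\<And>n s. s \<in> {0..t} \<Longrightarrow> norm (x n s) \<le> C"
    and r: "\<And>n. continuous_on {0..t} (r n)"
    and lim: "(\<lambda>n. integral {0..t} (\<lambda>s. (norm (r n s))\<^sup>2)) \<longlonglongrightarrow> 0"
  shows "(\<lambda>n. integral {0..t} (\<lambda>s. inner (x n s) (r n s))) \<longlonglongrightarrow> 0"
proof (rule LIMSEQ_I)
  fix e :: real assume "e > 0"
  have "C \<ge> 0" using order_trans[OF norm_ge_zero x(2)[of 0 0]] \<open>0 \<le> t\<close> by simp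
  \<comment> \<open>The 1 in the denominator covers \<open>C = 0\<close> and \<open>t = 0\<close>;
    the 2 reserves half of \<open>e\<close> for each of the two terms of \<open>est\<close>.\<close>
  define d where "d = e / (2 * (C\<^sup>2 * t + 1))"
  have "C\<^sup>2 * t + 1 > 0" using mult_nonneg_nonneg[OF zero_le_power2[of C] \<open>0 \<le> t\<close>] by linarith
  then have "d > 0" using \<open>e > 0\<close> by (simp add: d_def)
  have dC: "d * C\<^sup>2 * t < e / 2"
  proof -
    have "d * (C\<^sup>2 * t) < d * (C\<^sup>2 * t + 1)" using \<open>d > 0\<close> by simp
    also have "\<dots> = e / 2" using \<open>C\<^sup>2 * t + 1 > 0\<close> by (simp add: d_def field_simps)
    finally show ?thesis by (simp add: mult.assoc)
  qed
  have est: "norm (integral {0..t} (\<lambda>s. inner (x n s) (r n s)))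
      \<le> d * C\<^sup>2 * t + integral {0..t} (\<lambda>s. (norm (r n s))\<^sup>2) / d" for n
  proof -
    have pt: "norm (inner (x n s) (r n s)) \<le> d * C\<^sup>2 + (norm (r n s))\<^sup>2 / d" if "s \<in> {0..t}" for s
    proof -
      have "norm (inner (x n s) (r n s)) \<le> norm (x n s) * norm (r n s)"
        by (simp add: Cauchy_Schwarz_ineq2)
      also have "\<dots> \<le> C * norm (r n s)" using x(2)[OF that] by (intro mult_right_mono) auto
      also have "\<dots> \<le> d * C\<^sup>2 + (norm (r n s))\<^sup>2 / d"
      proof -
        define b where "b = norm (r n s)"
        \<comment> \<open>The square yields the cross term \<open>d * C * b\<close> twice; as it is
          nonnegative, one copy may be dropped.\<close>
        have "0 \<le> (d * C - b)\<^sup>2" "0 \<le> d * C * b" using \<open>d > 0\<close> \<open>C \<ge> 0\<close> by (auto simp: b_def)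
        then have "(C * b) * d \<le> (d * C\<^sup>2) * d + b\<^sup>2"
          by (simp add: power2_eq_square algebra_simps)
        then show ?thesis using \<open>d > 0\<close> by (fold b_def) (simp add: field_simps)
      qed
      finally show ?thesis .
    qed
    have "norm (integral {0..t} (\<lambda>s. inner (x n s) (r n s)))
        \<le> integral {0..t} (\<lambda>s. d * C\<^sup>2 + (norm (r n s))\<^sup>2 / d)"
      by (rule integral_norm_bound_integral)
        (use pt \<open>d > 0\<close> in \<open>auto intro!: integrable_continuous_real continuous_intros x r\<close>)
    also have "\<dots> = d * C\<^sup>2 * t + integral {0..t} (\<lambda>s. (norm (r n s))\<^sup>2) / d"
      using \<open>d > 0\<close> \<open>0 \<le> t\<close>
      by (subst integral_add) (auto intro!: integrable_continuous_real continuous_intros r)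
    finally show ?thesis .
  qed
  have "eventually (\<lambda>n. integral {0..t} (\<lambda>s. (norm (r n s))\<^sup>2) < d * e / 2) sequentially"
    using lim \<open>d > 0\<close> \<open>e > 0\<close> by (intro order_tendstoD(2)[OF lim]) auto
  then obtain N where N: "\<And>n. n \<ge> N \<Longrightarrow> integral {0..t} (\<lambda>s. (norm (r n s))\<^sup>2) < d * e / 2"
    by (auto simp: eventually_sequentially)
  show "\<exists>N. \<forall>n\<ge>N. norm (integral {0..t} (\<lambda>s. inner (x n s) (r n s)) - 0) < e"
  proof (intro exI allI impI)
    fix n assume "n \<ge> N"
    have "integral {0..t} (\<lambda>s. (norm (r n s))\<^sup>2) / d < e / 2"
      using N[OF \<open>n \<ge> N\<close>] \<open>d > 0\<close> by (simp add: field_simps)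
    then show "norm (integral {0..t} (\<lambda>s. inner (x n s) (r n s)) - 0) < e"
      using est[of n] dC unfolding real_norm_def diff_0_right by linarith
  qed
qed


section \<open>Time reversal and elementary calculus for curves\<close>

lemma integral_flip:
  fixes f :: "real \<Rightarrow> real"
  shows "integral {0..T} (\<lambda>t. f (T - t)) = integral {0..T} f"
proof -
  have "integral {0..T} (\<lambda>t. f (T - t)) = integral {- T..- 0} (\<lambda>t. f (T + t))"
    using Henstock_Kurzweil_Integration.integral_reflect_real[of 0 "- T" "\<lambda>t. f (T + t)"] by simp
  also have "\<dots> = integral {0..T} f"
    using integral_shift_cbox_plus[of "-T" 0 f T] by (simp add: o_def)
  finally show ?thesis .
qed

lemma has_vector_derivative_flip:
  fixes z :: "real \<Rightarrow> 'h::real_normed_vector"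
  assumes "\<And>t. t \<in> {0..T} \<Longrightarrow> (z has_vector_derivative z' t) (at t within {0..T})" "t \<in> {0..T}"
  shows "((\<lambda>s. z (T - s)) has_vector_derivative - z' (T - t)) (at t within {0..T})"
proof -
  have img: "(\<lambda>s. T - s) ` {0..T} = {0..T}" by (auto intro!: image_eqI[where x = "T - _"])
  have "((\<lambda>s. T - s) has_vector_derivative - 1) (at t within {0..T})"
    by (auto intro!: derivative_eq_intros)
  moreover have "(z has_vector_derivative z' (T - t)) (at (T - t) within (\<lambda>s. T - s) ` {0..T})"
    unfolding img using assms by auto
  ultimately have "((z \<circ> (\<lambda>s. T - s)) has_vector_derivative (- 1) *\<^sub>R z' (T - t)) (at t within {0..T})"
    by (rule vector_diff_chain_within)
  then show ?thesis by (simp add: o_def)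
qed

lemma DERIV_within_nonpos_imp_le:
  fixes f :: "real \<Rightarrow> real"
  assumes "a \<le> b" and deriv: "\<And>t. t \<in> {a..b} \<Longrightarrow> (f has_real_derivative f' t) (at t within {a..b})"
    and nonpos: "\<And>t. t \<in> {a..b} \<Longrightarrow> f' t \<le> 0"
  shows "f b \<le> f a"
proof (rule DERIV_nonpos_imp_decreasing_open[OF \<open>a \<le> b\<close>])
  fix t assume "a < t" "t < b"
  then have "(f has_real_derivative f' t) (at t)"
    using deriv[of t] at_within_Icc_at[of a t b] by simp
  then show "\<exists>y. (f has_real_derivative y) (at t) \<and> y \<le> 0"
    using nonpos[of t] \<open>a < t\<close> \<open>t < b\<close> by auto
next
  show "continuous_on {a..b} f"
    using deriv by (meson DERIV_continuous continuous_on_eq_continuous_within)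
qed

lemma has_vector_derivative_inner:
  assumes "(f has_vector_derivative f') (at x within s)" "(g has_vector_derivative g') (at x within s)"
  shows "((\<lambda>t. inner (f t) (g t)) has_real_derivative inner (f x) g' + inner f' (g x)) (at x within s)"
  using bounded_bilinear.has_vector_derivative[OF bounded_bilinear_inner assms]
  by (simp add: has_real_derivative_iff_has_vector_derivative)

text \<open>The set of vectors orthogonal to \<open>x - y\<close> is closed and contains
  \<open>D\<close>, hence contains \<open>x - y\<close> itself.\<close>

lemma orthogonal_dense_imp_eq:
  fixes x y :: "'h::real_inner"
  assumes "H \<subseteq> closure D" "subspace H" "x \<in> H" "y \<in> H" "\<And>v. v \<in> D \<Longrightarrow> inner x v = inner y v"
  shows "x = y"
proof -
  have "x - y \<in> closure D" using assms by (auto intro: subspace_diff)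
  moreover have "closed {v. inner (x - y) v = 0}" by (simp add: closed_hyperplane)
  moreover have "D \<subseteq> {v. inner (x - y) v = 0}" using assms(5) by (auto simp: inner_diff_left)
  ultimately have "x - y \<in> {v. inner (x - y) v = 0}" by (meson closure_minimal subsetD)
  then show ?thesis by simp
qed

section \<open>The evolution defined by approximate solutions\<close>

text \<open>\<open>H\<close> is a subset and only \<open>H\<close> is assumed complete, since the
  type that will carry L2 is an algebraic direct sum over all measures. \<open>approximable\<close>
  is the form in which the space-time density enters: an exact initial value and a residual small in
  square mean.\<close>

locale approximable_evolution =
  fixes H D :: "'h::real_inner set" and A :: "'h \<Rightarrow> 'h" and c :: real
  assumes subspace_H: "subspace H" and complete_H: "complete H"
    and subspace_D: "subspace D" and D_subset: "D \<subseteq> H" and dense: "H \<subseteq> closure D"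
    and A_in: "\<And>u. u \<in> D \<Longrightarrow> A u \<in> H"
    and A_add: "\<And>u v. u \<in> D \<Longrightarrow> v \<in> D \<Longrightarrow> A (u + v) = A u + A v"
    and A_scale: "\<And>a u. u \<in> D \<Longrightarrow> A (a *\<^sub>R u) = a *\<^sub>R A u"
    and A_sym: "\<And>u v. u \<in> D \<Longrightarrow> v \<in> D \<Longrightarrow> inner (A u) v = inner u (A v)"
    and A_bound: "\<And>u. u \<in> D \<Longrightarrow> inner (A u) u \<le> c * (norm u)\<^sup>2"
    and c_nonneg: "c \<ge> 0"
    and approximable: "\<And>T u e. T > 0 \<Longrightarrow> u \<in> D \<Longrightarrow> e > 0 \<Longrightarrow> \<exists>z r. z 0 = u
      \<and> (\<forall>t\<in>{0..T}. z t \<in> D \<and> (z has_vector_derivative A (z t) + r t) (at t within {0..T}))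
      \<and> continuous_on {0..T} r \<and> integral {0..T} (\<lambda>t. (norm (r t))\<^sup>2) < e"
begin

section \<open>Curves with residuals and the energy estimate\<close>

definition curve :: "real \<Rightarrow> (real \<Rightarrow> 'h) \<Rightarrow> (real \<Rightarrow> 'h) \<Rightarrow> bool" where
  "curve T z r \<longleftrightarrow> (\<forall>t\<in>{0..T}. z t \<in> D \<and> (z has_vector_derivative A (z t) + r t) (at t within {0..T}))
     \<and> continuous_on {0..T} r"

definition cost :: "real \<Rightarrow> (real \<Rightarrow> 'h) \<Rightarrow> real" where
  "cost T r = integral {0..T} (\<lambda>t. (norm (r t))\<^sup>2)"

text \<open>The rate of the energy estimate: \<open>2 * c\<close> comes from the upper bound of
  \<open>A\<close> in the derivative of the squared norm, the 1 from estimating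
  \<open>2 * inner (r s) (z s)\<close> by the sum of the two squared norms.\<close>

definition growth :: "real \<Rightarrow> real" where
  "growth t = exp ((2 * c + 1) * t)"

lemma growth_pos: "growth t > 0"
  by (simp add: growth_def)

lemma growth_mono: "s \<le> t \<Longrightarrow> growth s \<le> growth t"
  using c_nonneg by (simp add: growth_def mult_left_mono)

lemma curveD:
  assumes "curve T z r" "t \<in> {0..T}"
  shows "z t \<in> D" "(z has_vector_derivative A (z t) + r t) (at t within {0..T})"
  using assms by (auto simp: curve_def)

lemma curve_continuous: "curve T z r \<Longrightarrow> continuous_on {0..T} z"
  by (rule continuous_on_vector_derivative) (rule curveD(2))

lemma curve_residual_continuous: "curve T z r \<Longrightarrow> continuous_on {0..T} r"
  by (simp add: curve_def)

lemma curve_add: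
  assumes "curve T z r" "curve T y s" shows "curve T (\<lambda>t. z t + y t) (\<lambda>t. r t + s t)"
proof -
  have "((\<lambda>t. z t + y t) has_vector_derivative A (z t + y t) + (r t + s t)) (at t within {0..T})"
    if "t \<in> {0..T}" for t
    using has_vector_derivative_add[OF curveD(2)[OF assms(1) that] curveD(2)[OF assms(2) that]]
    by (simp add: A_add curveD(1)[OF assms(1) that] curveD(1)[OF assms(2) that] algebra_simps)
  then show ?thesis using assms
    by (auto simp: curve_def intro!: subspace_add[OF subspace_D] continuous_intros)
qed

lemma curve_scale:
  assumes "curve T z r" shows "curve T (\<lambda>t. a *\<^sub>R z t) (\<lambda>t. a *\<^sub>R r t)"
proof -
  have "((\<lambda>t. a *\<^sub>R z t) has_vector_derivative A (a *\<^sub>R z t) + a *\<^sub>R r t) (at t within {0..T})"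
    if "t \<in> {0..T}" for t
    using bounded_linear.has_vector_derivative[OF bounded_linear_scaleR_right curveD(2)[OF assms that], of
      a]
    by (simp add: A_scale curveD(1)[OF assms that] algebra_simps)
  then show ?thesis using assms
    by (auto simp: curve_def intro!: subspace_scale[OF subspace_D] continuous_intros)
qed

lemma curve_restrict:
  assumes "curve T z r" "t \<le> T" shows "curve t z r"
proof -
  have "(z has_vector_derivative A (z s) + r s) (at s within {0..t})" if "s \<in> {0..t}" for s
    using assms that by (intro has_vector_derivative_within_subset[OF curveD(2)[OF assms(1)]]) auto
  then show ?thesis using assms by (auto simp: curve_def intro: continuous_on_subset)
qed

lemma curve_shift:
  assumes "curve (s + t) z r" "0 \<le> s" shows "curve t (\<lambda>\<tau>. z (s + \<tau>)) (\<lambda>\<tau>. r (s + \<tau>))"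
proof -
  have "((\<lambda>\<tau>. z (s + \<tau>)) has_vector_derivative A (z (s + \<tau>)) + r (s + \<tau>)) (at \<tau> within {0..t})"
    if "\<tau> \<in> {0..t}" for \<tau>
  proof -
    have "((\<lambda>\<tau>. s + \<tau>) has_vector_derivative 1) (at \<tau> within {0..t})"
      by (auto intro!: derivative_eq_intros)
    moreover have "(z has_vector_derivative A (z (s + \<tau>)) + r (s + \<tau>)) (at (s + \<tau>) within (+) s ` {0..t})"
      using assms that by (intro has_vector_derivative_within_subset[OF curveD(2)[OF assms(1)]]) auto
    ultimately show ?thesis using vector_diff_chain_within[of "(+) s" 1 \<tau> "{0..t}" z] by (simp add: o_def)
  qed
  moreover have "continuous_on {0..t} (\<lambda>\<tau>. r (s + \<tau>))"
    using assms by (intro continuous_on_compose2[OF curve_residual_continuous[OF assms(1)]]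
      continuous_intros) auto
  moreover have "z (s + \<tau>) \<in> D" if "\<tau> \<in> {0..t}" for \<tau>
    using curveD(1)[OF assms(1), of "s + \<tau>"] that assms(2) by auto
  ultimately show ?thesis by (simp add: curve_def)
qed

lemma curve_const: "u \<in> D \<Longrightarrow> curve T (\<lambda>_. u) (\<lambda>_. - A u)"
  by (auto simp: curve_def)

lemma norm_power2_integrable: "curve T z r \<Longrightarrow> (\<lambda>t. (norm (r t))\<^sup>2) integrable_on {0..T}"
  using integrable_continuous_real[OF continuous_on_power[OF
    continuous_on_norm[OF curve_residual_continuous]]] .

lemma cost_nonneg: "curve T z r \<Longrightarrow> 0 \<le> cost T r"
  unfolding cost_def by (rule integral_nonneg[OF norm_power2_integrable]) auto

lemma cost_mono: "curve T z r \<Longrightarrow> t \<le> T \<Longrightarrow> cost t r \<le> cost T r"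
  unfolding cost_def
  by (rule integral_subset_le)
    (auto intro: norm_power2_integrable dest: curve_restrict)

lemma cost_shift_le:
  assumes "curve (s + t) z r" "0 \<le> s" "0 \<le> t"
  shows "cost t (\<lambda>\<tau>. r (s + \<tau>)) \<le> cost (s + t) r"
proof -
  have "cost t (\<lambda>\<tau>. r (s + \<tau>)) = integral {s..s + t} (\<lambda>\<tau>. (norm (r \<tau>))\<^sup>2)"
    using integral_shift_cbox_plus[of 0 t "\<lambda>\<tau>. (norm (r \<tau>))\<^sup>2" s]
    by (simp add: o_def cost_def add.commute)
  also have "\<dots> \<le> cost (s + t) r"
    unfolding cost_def using assms norm_power2_integrable[OF assms(1)]
    by (intro integral_subset_le) (auto intro: integrable_on_subinterval)
  finally show ?thesis .
qed

text \<open>The discounted energy \<open>exp (- k * s) * inner (z s) (z s)\<close> minus the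
  accumulated squared residual is nonincreasing. The discount on the residual is replaced by 1,
  which is allowed because \<open>k * s\<close> is nonnegative.\<close>

lemma gronwall:
  assumes z: "curve T z r" and t: "0 \<le> t" "t \<le> T"
  shows "(norm (z t))\<^sup>2 \<le> growth t * ((norm (z 0))\<^sup>2 + cost t r)"
proof -
  define k where "k = 2 * c + 1"
  define q where "q s = exp (- k * s) * inner (z s) (z s) - integral {0..s} (\<lambda>\<tau>. (norm (r \<tau>))\<^sup>2)" for s
  define q' where "q' s = exp (- k * s) *
    (2 * inner (A (z s)) (z s) + 2 * inner (r s) (z s) - k * inner (z s) (z s))
      - (norm (r s))\<^sup>2" for s
  have z': "curve t z r" using z t curve_restrict by blast
  have "(q has_real_derivative q' s) (at s within {0..t})" if "s \<in> {0..t}" for s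
  proof -
    note d = curveD(2)[OF z' that]
    have i: "((\<lambda>s. integral {0..s} (\<lambda>\<tau>. (norm (r \<tau>))\<^sup>2)) has_real_derivative (norm (r s))\<^sup>2)
      (at s within {0..t})"
      using that by (intro integral_has_real_derivative continuous_intros
        curve_residual_continuous[OF z'])
    have e: "((\<lambda>s. exp (- k * s)) has_real_derivative - k * exp (- k * s)) (at s within {0..t})"
      by (auto intro!: derivative_eq_intros)
    show ?thesis
      unfolding q_def
      using DERIV_diff[OF DERIV_mult[OF e has_vector_derivative_inner[OF d d]] i]
      by (rule DERIV_cong) (simp add: q'_def inner_simps inner_commute algebra_simps)
  qed
  moreover have "q' s \<le> 0" if "s \<in> {0..t}" for s
  proof -
    have "2 * inner (A (z s)) (z s) \<le> 2 * c * inner (z s) (z s)"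
      using A_bound[OF curveD(1)[OF z' that]] by (simp add: power2_norm_eq_inner)
    moreover have "2 * inner (r s) (z s) \<le> inner (r s) (r s) + inner (z s) (z s)"
      using inner_ge_zero[of "r s - z s"] by (simp add: inner_simps inner_commute)
    ultimately have "2 * inner (A (z s)) (z s) + 2 * inner (r s) (z s) - k * inner (z s) (z s)
      \<le> inner (r s) (r s)"
      by (simp add: k_def algebra_simps)
    then have "exp (- k * s) * (2 * inner (A (z s)) (z s) + 2 * inner (r s) (z s) - k * inner (z s) (z s))
        \<le> exp (- k * s) * inner (r s) (r s)"
      by (intro mult_left_mono) auto
    also have "\<dots> \<le> 1 * inner (r s) (r s)"
    proof -
      have "0 \<le> k * s" using that c_nonneg by (simp add: k_def)
      then show ?thesis by (intro mult_right_mono) auto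
    qed
    finally show ?thesis by (simp add: q'_def power2_norm_eq_inner)
  qed
  ultimately have "q t \<le> q 0"
    using DERIV_within_nonpos_imp_le[of 0 t q q'] t(1) by blast
  then have "exp (- k * t) * (norm (z t))\<^sup>2 \<le> (norm (z 0))\<^sup>2 + cost t r"
    by (simp add: q_def cost_def power2_norm_eq_inner)
  then have "exp (k * t) * (exp (- k * t) * (norm (z t))\<^sup>2) \<le> exp (k * t) * ((norm (z 0))\<^sup>2 + cost t r)"
    by (intro mult_left_mono) auto
  moreover have "exp (k * t) * (exp (- k * t) * x) = x" for x
    by (simp flip: mult.assoc exp_add)
  ultimately show ?thesis unfolding growth_def k_def[symmetric] by (simp only:)
qed

text \<open>By linearity the difference of two curves is a curve with residual
  \<open>r t - s t\<close>, so \<open>gronwall\<close> applies to it. Growth and costs are taken at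
  \<open>T\<close> to make the bound uniform in \<open>t\<close>.\<close>

lemma stability:
  assumes z: "curve T z r" "curve T y s" and t: "0 \<le> t" "t \<le> T"
  shows "(norm (z t - y t))\<^sup>2 \<le> growth T * ((norm (z 0 - y 0))\<^sup>2 + 2 * cost T r + 2 * cost T s)"
proof -
  have "curve T (\<lambda>t. z t + (-1) *\<^sub>R y t) (\<lambda>t. r t + (-1) *\<^sub>R s t)"
    using z by (intro curve_add curve_scale)
  then have c: "curve T (\<lambda>t. z t - y t) (\<lambda>t. r t - s t)" by simp
  have "(norm (z t - y t))\<^sup>2 \<le> growth t * ((norm (z 0 - y 0))\<^sup>2 + cost t (\<lambda>t. r t - s t))"
    using gronwall[OF c t] by simp
  also have "\<dots> \<le> growth T * ((norm (z 0 - y 0))\<^sup>2 + cost T (\<lambda>t. r t - s t))"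
    using cost_mono[OF c t(2)] growth_mono[OF t(2)] cost_nonneg[OF curve_restrict[OF c t(2)]]
      growth_pos[of T]
    by (intro mult_mono) auto
  also have "\<dots> \<le> growth T * ((norm (z 0 - y 0))\<^sup>2 + (2 * cost T r + 2 * cost T s))"
  proof -
    have "cost T (\<lambda>t. r t - s t) \<le> 2 * cost T r + 2 * cost T s"
      using integral_power2_norm_add_le[of T r "\<lambda>t. - s t"] curve_residual_continuous[OF z(1)]
        curve_residual_continuous[OF z(2)]
      by (simp add: cost_def continuous_on_minus)
    then show ?thesis using growth_pos[of T] by (intro mult_left_mono add_left_mono) auto
  qed
  finally show ?thesis by (simp add: add.assoc)
qed

text \<open>Differentiate \<open>(z s, y (t - s))\<close> in \<open>s\<close>; since a C0 semigroup is a priori only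
  differentiable from the right, so is \<open>z\<close>, and it solves the equation only weakly.\<close>
lemma duality:
  assumes "0 \<le> t" and y: "curve t y \<rho>" and z: "continuous_on {0..t} z" and b: "continuous_on {0..t} b"
    and deriv: "\<And>s. 0 \<le> s \<Longrightarrow> s < t \<Longrightarrow> (z has_vector_derivative z' s) (at_right s)"
    and weak: "\<And>s v. 0 \<le> s \<Longrightarrow> s < t \<Longrightarrow> v \<in> D \<Longrightarrow> inner (z' s) v = inner (z s) (A v) + inner (b s) v"
  shows "inner (z t) (y 0) - inner (z 0) (y t)
    = integral {0..t} (\<lambda>s. inner (b s) (y (t - s))) - integral {0..t} (\<lambda>s. inner (z s) (\<rho> (t - s)))"
proof -
  have y_cont: "continuous_on {0..t} (\<lambda>s. y (t - s))"
    by (intro continuous_on_compose2[OF curve_continuous[OF y]] continuous_intros) auto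
  have \<rho>_cont: "continuous_on {0..t} (\<lambda>s. \<rho> (t - s))"
    by (intro continuous_on_compose2[OF curve_residual_continuous[OF y]] continuous_intros) auto
  have "inner (z t) (y (t - t)) - inner (z 0) (y (t - 0))
      = integral {0..t} (\<lambda>s. inner (b s) (y (t - s)) - inner (z s) (\<rho> (t - s)))"
  proof (rule fundamental_theorem_of_calculus_right[OF \<open>0 \<le> t\<close>])
    show "continuous_on {0..t} (\<lambda>s. inner (z s) (y (t - s)))"
      by (intro continuous_intros z y_cont)
    show "continuous_on {0..t} (\<lambda>s. inner (b s) (y (t - s)) - inner (z s) (\<rho> (t - s)))"
      by (intro continuous_intros z b y_cont \<rho>_cont)
    fix s assume s: "0 \<le> s" "s < t"
    have "((\<lambda>s. y (t - s)) has_vector_derivative - (A (y (t - s)) + \<rho> (t - s))) (at s within {0..t})"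
      using s by (intro has_vector_derivative_flip[where z' = "\<lambda>s. A (y s) + \<rho> s"] curveD(2)[OF y]) auto
    then have "((\<lambda>s. y (t - s)) has_vector_derivative - (A (y (t - s)) + \<rho> (t - s))) (at_right s)"
      using s by (rule has_vector_derivative_at_right)
    \<comment> \<open>The term \<open>inner (z s) (A (y (t - s)))\<close> arises with a plus sign
      from \<open>weak\<close> and with a minus sign from the reversed derivative of
      \<open>y\<close>. It cancels, and \<open>A\<close> is never applied to
      \<open>z\<close>.\<close>
    from has_vector_derivative_inner[OF deriv[OF s] this]
    show "((\<lambda>s. inner (z s) (y (t - s))) has_real_derivative
        inner (b s) (y (t - s)) - inner (z s) (\<rho> (t - s))) (at_right s)"
      by (rule DERIV_cong) (use s weak[OF s] curveD(1)[OF y, of "t - s"] in \<open>simp add: inner_simps\<close>)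
  qed
  also have "\<dots> = integral {0..t} (\<lambda>s. inner (b s) (y (t - s)))
    - integral {0..t} (\<lambda>s. inner (z s) (\<rho> (t - s)))"
    by (intro integral_diff integrable_continuous_real continuous_intros z b y_cont \<rho>_cont)
  finally show ?thesis by simp
qed

text \<open>\<open>A_sym\<close> makes every curve a weak solution in the sense of
  \<open>duality\<close>, with inhomogeneity \<open>r\<close>.\<close>

lemma curve_duality:
  assumes "0 \<le> t" "curve t z r" "curve t y \<rho>"
  shows "inner (z t) (y 0) - inner (z 0) (y t)
    = integral {0..t} (\<lambda>s. inner (r s) (y (t - s))) - integral {0..t} (\<lambda>s. inner (z s) (\<rho> (t - s)))"
proof (rule duality[where z' = "\<lambda>s. A (z s) + r s", OF assms(1,3)])
  fix s v assume s: "0 \<le> s" "s < t"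
  show "(z has_vector_derivative A (z s) + r s) (at_right s)"
    using s by (intro has_vector_derivative_at_right[of _ _ _ 0 t] curveD(2)[OF assms(2)]) auto
  assume "v \<in> D"
  then show "inner (A (z s) + r s) v = inner (z s) (A v) + inner (r s) v"
    using s A_sym[OF curveD(1)[OF assms(2), of s], of v] by (simp add: inner_add_left)
qed (use assms curve_continuous curve_residual_continuous in auto)

text \<open>The initial values need only converge, because \<open>u\<close> will range over
  \<open>H\<close> while curves stay in \<open>D\<close>.\<close>

definition approximates :: "real \<Rightarrow> 'h \<Rightarrow> (nat \<Rightarrow> real \<Rightarrow> 'h) \<Rightarrow> (nat \<Rightarrow> real \<Rightarrow> 'h) \<Rightarrow> bool" where
  "approximates T u z r \<longleftrightarrow> (\<forall>n. curve T (z n) (r n)) \<and> (\<lambda>n. z n 0) \<longlonglongrightarrow> u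
     \<and> (\<lambda>n. cost T (r n)) \<longlonglongrightarrow> 0"

lemma approximatesD:
  assumes "approximates T u z r"
  shows "curve T (z n) (r n)" "(\<lambda>n. z n 0) \<longlonglongrightarrow> u" "(\<lambda>n. cost T (r n)) \<longlonglongrightarrow> 0"
  using assms by (auto simp: approximates_def)

lemma approximates_restrict:
  assumes "approximates T u z r" "t \<le> T" shows "approximates t u z r"
  unfolding approximates_def
proof (intro conjI allI)
  show c: "curve t (z n) (r n)" for n using approximatesD(1)[OF assms(1)] assms(2) curve_restrict by blast
  show "(\<lambda>n. cost t (r n)) \<longlonglongrightarrow> 0"
    by (rule tendsto_sandwich[OF _ _ tendsto_const approximatesD(3)[OF assms(1)]])
      (use cost_nonneg[OF c] cost_mono[OF approximatesD(1)[OF assms(1)] assms(2)] in auto)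
qed (use approximatesD(2)[OF assms(1)] in auto)

text \<open>The initial values can be prescribed in \<open>D\<close>; a constant sequence gives
  curves that all start exactly at a given vector, as the uniqueness argument requires.\<close>

lemma ex_approximates_sequence:
  assumes "T \<ge> 0" and d: "\<And>n. d n \<in> D" "d \<longlonglongrightarrow> u"
  shows "\<exists>z r. approximates T u z r \<and> (\<forall>n. z n 0 = d n)"
proof -
  \<comment> \<open>\<open>approximable\<close> needs a positive horizon; \<open>T + 1\<close>
    covers \<open>T = 0\<close> and is cut back to \<open>T\<close> at the end.\<close>
  have "\<exists>z r. z 0 = d n \<and> curve (T + 1) z r \<and> cost (T + 1) r < inverse (real (Suc n))" for n
    using approximable[of "T + 1" "d n" "inverse (real (Suc n))"] assms
    by (auto simp: curve_def cost_def)
  then obtain z r where zr: "\<And>n. z n 0 = d n" "\<And>n. curve (T + 1) (z n) (r n)"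
    "\<And>n. cost (T + 1) (r n) < inverse (real (Suc n))"
    by metis
  have "(\<lambda>n. cost (T + 1) (r n)) \<longlonglongrightarrow> 0"
    by (rule tendsto_sandwich[OF _ _ tendsto_const LIMSEQ_inverse_real_of_nat])
      (use zr(3) cost_nonneg[OF zr(2)] in
        \<open>auto simp del: of_nat_Suc intro!: always_eventually less_imp_le\<close>)
  then have "approximates (T + 1) u z r" using zr d by (simp add: approximates_def)
  then have "approximates T u z r" by (rule approximates_restrict) simp
  then show ?thesis using zr by blast
qed

lemma ex_approximates:
  assumes "T \<ge> 0" "u \<in> H" shows "\<exists>z r. approximates T u z r"
proof -
  have "u \<in> closure D" using assms dense by auto
  then obtain d where "\<And>n. d n \<in> D" "d \<longlonglongrightarrow> u" by (auto simp: closure_sequential)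
  then show ?thesis using ex_approximates_sequence[OF assms(1)] by blast
qed

text \<open>Time reversal preserves the cost, so residuals run backwards, as \<open>duality\<close>
  produces them, still vanish in the limit.\<close>

lemma flipped_pairing_tendsto_zero:
  assumes a: "approximates t u z r" and "0 \<le> t"
    and x: "\<And>n. continuous_on {0..t} (x n)" "\<And>n s. s \<in> {0..t} \<Longrightarrow> norm (x n s) \<le> C"
  shows "(\<lambda>n. integral {0..t} (\<lambda>s. inner (x n s) (r n (t - s)))) \<longlonglongrightarrow> 0"
proof (rule integral_pairing_tendsto_zero[OF \<open>0 \<le> t\<close> x])
  show "continuous_on {0..t} (\<lambda>s. r n (t - s))" for n
    by (intro continuous_on_compose2[OF curve_residual_continuous[OF approximatesD(1)[OF a]]]
      continuous_intros) auto
  show "(\<lambda>n. integral {0..t} (\<lambda>s. (norm (r n (t - s)))\<^sup>2)) \<longlonglongrightarrow> 0"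
    using approximatesD(3)[OF a] by (simp add: cost_def integral_flip[of t "\<lambda>s. (norm (r _ s))\<^sup>2"])
qed

text \<open>With zero inhomogeneity the only error in \<open>duality\<close> is a pairing of the
  bounded curve \<open>z\<close> with a residual. The sequence in the conclusion sees
  \<open>z\<close> only through \<open>z 0\<close>, which is the source of uniqueness.\<close>

lemma weak_solution_pairing:
  assumes "0 \<le> t" and y: "approximates t v y \<rho>" "\<And>n. y n 0 = v"
    and z: "continuous_on {0..t} z"
    and deriv: "\<And>s. 0 \<le> s \<Longrightarrow> s < t \<Longrightarrow> (z has_vector_derivative z' s) (at_right s)"
    and weak: "\<And>s v. 0 \<le> s \<Longrightarrow> s < t \<Longrightarrow> v \<in> D \<Longrightarrow> inner (z' s) v = inner (z s) (A v)"
  shows "(\<lambda>n. inner (z 0) (y n t)) \<longlonglongrightarrow> inner (z t) v"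
proof -
  have "compact (z ` {0..t})" using z by (intro compact_continuous_image) auto
  then obtain C where C: "\<And>s. s \<in> {0..t} \<Longrightarrow> norm (z s) \<le> C"
    using bounded_iff[of "z ` {0..t}"] compact_imp_bounded by blast
  have eq: "inner (z 0) (y n t) = inner (z t) v + integral {0..t} (\<lambda>s. inner (z s) (\<rho> n (t - s)))" for n
    using duality[OF assms(1) approximatesD(1)[OF y(1), of n] z, of "\<lambda>_. 0" z'] deriv weak y(2)[of n]
      by simp
  have lim: "(\<lambda>n. integral {0..t} (\<lambda>s. inner (z s) (\<rho> n (t - s)))) \<longlonglongrightarrow> 0"
    by (rule flipped_pairing_tendsto_zero[OF y(1) \<open>0 \<le> t\<close> z C])
  show ?thesis
    unfolding eq using tendsto_add[OF tendsto_const lim, of "inner (z t) v"] by simp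
qed

text \<open>By \<open>weak_solution_pairing\<close>, \<open>inner (z t) v\<close> and
  \<open>inner (y t) v\<close> are limits of one and the same sequence.\<close>

lemma weak_solution_unique:
  assumes "0 \<le> t"
    and z: "continuous_on {0..t} z" "\<And>s. 0 \<le> s \<Longrightarrow> s < t \<Longrightarrow> (z has_vector_derivative z' s) (at_right s)"
      "\<And>s v. 0 \<le> s \<Longrightarrow> s < t \<Longrightarrow> v \<in> D \<Longrightarrow> inner (z' s) v = inner (z s) (A v)"
    and y: "continuous_on {0..t} y" "\<And>s. 0 \<le> s \<Longrightarrow> s < t \<Longrightarrow> (y has_vector_derivative y' s) (at_right s)"
      "\<And>s v. 0 \<le> s \<Longrightarrow> s < t \<Longrightarrow> v \<in> D \<Longrightarrow> inner (y' s) v = inner (y s) (A v)"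
    and "z 0 = y 0" "z t \<in> H" "y t \<in> H"
  shows "z t = y t"
proof (rule orthogonal_dense_imp_eq[OF dense subspace_H \<open>z t \<in> H\<close> \<open>y t \<in> H\<close>])
  fix v assume "v \<in> D"
  then obtain w \<rho> where w: "approximates t v w \<rho>" "\<And>n. w n 0 = v"
    using ex_approximates_sequence[OF \<open>0 \<le> t\<close>, of "\<lambda>_. v" v] by auto
  show "inner (z t) v = inner (y t) v"
    using LIMSEQ_unique[OF weak_solution_pairing[OF \<open>0 \<le> t\<close> w z]]
      weak_solution_pairing[OF \<open>0 \<le> t\<close> w y] \<open>z 0 = y 0\<close> by simp
qed

text \<open>The sequence is chosen anew for every \<open>t\<close> and \<open>u\<close>; that
  neither the choice nor the horizon matters is the content of \<open>evolution_lim\<close>.\<close>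

definition evolution :: "real \<Rightarrow> 'h \<Rightarrow> 'h" where
  "evolution t u = lim (\<lambda>n. (SOME z. \<exists>r. approximates t u z r) n t)"

lemma approximates_dist_le:
  assumes "approximates T u z r" "approximates T v y s" "0 \<le> t" "t \<le> T"
  shows "(norm (z n t - y m t))\<^sup>2
    \<le> growth T * ((norm (z n 0 - y m 0))\<^sup>2 + 2 * cost T (r n) + 2 * cost T (s m))"
  using stability[OF approximatesD(1)[OF assms(1)] approximatesD(1)[OF assms(2)] assms(3,4)] .

lemma approximates_dist_tendsto:
  assumes "approximates T u z r" "approximates T u y s" "0 \<le> t" "t \<le> T"
  shows "(\<lambda>n. z n t - y n t) \<longlonglongrightarrow> 0"
proof -
  have "(\<lambda>n. growth T * ((norm (z n 0 - y n 0))\<^sup>2 + 2 * cost T (r n) + 2 * cost T (s n)))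
      \<longlonglongrightarrow> growth T * ((norm (u - u))\<^sup>2 + 2 * 0 + 2 * 0)"
    by (intro tendsto_intros approximatesD(2,3)[OF assms(1)] approximatesD(2,3)[OF assms(2)])
  then have "(\<lambda>n. growth T * ((norm (z n 0 - y n 0))\<^sup>2 + 2 * cost T (r n) + 2 * cost T (s n))) \<longlonglongrightarrow> 0"
    by simp
  then have "(\<lambda>n. (norm (z n t - y n t))\<^sup>2) \<longlonglongrightarrow> 0"
    by (rule tendsto_sandwich[OF _ _ tendsto_const, rotated 2])
      (auto intro!: always_eventually approximates_dist_le assms)
  then have "(\<lambda>n. sqrt ((norm (z n t - y n t))\<^sup>2)) \<longlonglongrightarrow> sqrt 0" by (rule tendsto_real_sqrt)
  then show ?thesis by (simp add: tendsto_norm_zero_iff)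
qed

lemma approximates_Cauchy:
  assumes a: "approximates T u z r" and t: "0 \<le> t" "t \<le> T"
  shows "Cauchy (\<lambda>n. z n t)"
proof (rule metric_CauchyI)
  fix e :: real assume "e > 0"
  \<comment> \<open>Five shares: one for the squared distance of the initial values and two for each
    of the two costs.\<close>
  define d where "d = e\<^sup>2 / (5 * growth T)"
  have "d > 0" using \<open>e > 0\<close> growth_pos by (simp add: d_def)
  have "Cauchy (\<lambda>n. z n 0)" using approximatesD(2)[OF a] by (rule LIMSEQ_imp_Cauchy)
  then obtain N where N: "\<And>n m. n \<ge> N \<Longrightarrow> m \<ge> N \<Longrightarrow> norm (z n 0 - z m 0) < sqrt d"
    using \<open>d > 0\<close> unfolding Cauchy_iff by (meson real_sqrt_gt_zero)
  have "eventually (\<lambda>n. cost T (r n) < d) sequentially"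
    using approximatesD(3)[OF a] \<open>d > 0\<close> by (rule order_tendstoD(2))
  then obtain N' where N': "\<And>n. n \<ge> N' \<Longrightarrow> cost T (r n) < d" by (auto simp: eventually_sequentially)
  show "\<exists>M. \<forall>m\<ge>M. \<forall>n\<ge>M. dist (z m t) (z n t) < e"
  proof (intro exI allI impI)
    fix m n assume mn: "m \<ge> max N N'" "n \<ge> max N N'"
    have "(norm (z m 0 - z n 0))\<^sup>2 < (sqrt d)\<^sup>2"
      using N[of m n] mn by (intro power_strict_mono) auto
    then have "(norm (z m 0 - z n 0))\<^sup>2 + 2 * cost T (r m) + 2 * cost T (r n) < 5 * d"
      using N'[of m] N'[of n] mn \<open>d > 0\<close> by simp
    then have "growth T * ((norm (z m 0 - z n 0))\<^sup>2 + 2 * cost T (r m) + 2 * cost T (r n))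
      < growth T * (5 * d)"
      using growth_pos by simp
    also have "\<dots> = e\<^sup>2" using growth_pos[of T] by (simp add: d_def)
    finally have "(norm (z m t - z n t))\<^sup>2 < e\<^sup>2"
      using approximates_dist_le[OF a a t, of m n] by linarith
    then show "dist (z m t) (z n t) < e"
      using \<open>e > 0\<close> by (simp add: dist_norm power_less_imp_less_base)
  qed
qed

text \<open>The difference from the sequence chosen in the definition tends to zero by
  \<open>stability\<close>. The chosen sequence converges because it is Cauchy and \<open>H\<close>
  is complete.\<close>

lemma evolution_lim:
  assumes a: "approximates T u z r" and "0 \<le> t" "t \<le> T" and "u \<in> H"
  shows "(\<lambda>n. z n t) \<longlonglongrightarrow> evolution t u" "evolution t u \<in> H"
proof -
  define y where "y = (SOME z. \<exists>r. approximates t u z r)"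
  have "\<exists>s. approximates t u y s"
    unfolding y_def using ex_approximates[OF \<open>0 \<le> t\<close> \<open>u \<in> H\<close>] by (rule someI_ex)
  then obtain s where y: "approximates t u y s" by blast
  have "y n t \<in> H" for n using curveD(1)[OF approximatesD(1)[OF y], of t] \<open>0 \<le> t\<close> D_subset by auto
  then obtain x where x: "x \<in> H" "(\<lambda>n. y n t) \<longlonglongrightarrow> x"
    using completeE[OF complete_H _ approximates_Cauchy[OF y \<open>0 \<le> t\<close> order_refl]] by metis
  have ev: "evolution t u = x" unfolding evolution_def y_def[symmetric] using x(2) by (rule limI)
  have "(\<lambda>n. z n t - y n t) \<longlonglongrightarrow> 0"
    using approximates_dist_tendsto[OF approximates_restrict[OF a \<open>t \<le> T\<close>] y \<open>0 \<le> t\<close> order_refl] .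
  from tendsto_add[OF this x(2)] show "(\<lambda>n. z n t) \<longlonglongrightarrow> evolution t u" by (simp add: ev)
  show "evolution t u \<in> H" using x ev by simp
qed

section \<open>The limit semigroup\<close>

lemma evolution_in: "0 \<le> t \<Longrightarrow> u \<in> H \<Longrightarrow> evolution t u \<in> H"
  using ex_approximates[of t u] evolution_lim(2)[of t u _ _ t] by auto

lemma evolution_0:
  assumes "u \<in> H" shows "evolution 0 u = u"
proof -
  obtain z r where a: "approximates 0 u z r" using ex_approximates[of 0 u] assms by auto
  show ?thesis
    using LIMSEQ_unique[OF evolution_lim(1)[OF a _ _ assms, of 0] approximatesD(2)[OF a]] by simp
qed

lemma evolution_add:
  assumes "0 \<le> t" "u \<in> H" "v \<in> H"
  shows "evolution t (u + v) = evolution t u + evolution t v"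
proof -
  obtain z r where a: "approximates t u z r" using ex_approximates assms by blast
  obtain y s where b: "approximates t v y s" using ex_approximates assms by blast
  have c: "curve t (\<lambda>\<tau>. z n \<tau> + y n \<tau>) (\<lambda>\<tau>. r n \<tau> + s n \<tau>)" for n
    using approximatesD(1)[OF a] approximatesD(1)[OF b] by (rule curve_add)
  \<comment> \<open>Costs are not additive, but the parallelogram bound still forces the cost of the
    sum to zero.\<close>
  have le: "cost t (\<lambda>\<tau>. r n \<tau> + s n \<tau>) \<le> 2 * cost t (r n) + 2 * cost t (s n)" for n
    unfolding cost_def using approximatesD(1)[OF a] approximatesD(1)[OF b]
    by (intro integral_power2_norm_add_le curve_residual_continuous)
  have "(\<lambda>n. 2 * cost t (r n) + 2 * cost t (s n)) \<longlonglongrightarrow> 2 * 0 + 2 * 0"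
    by (intro tendsto_intros approximatesD(3)[OF a] approximatesD(3)[OF b])
  then have lim: "(\<lambda>n. 2 * cost t (r n) + 2 * cost t (s n)) \<longlonglongrightarrow> 0" by simp
  have "(\<lambda>n. cost t (\<lambda>\<tau>. r n \<tau> + s n \<tau>)) \<longlonglongrightarrow> 0"
    by (rule tendsto_sandwich[OF _ _ tendsto_const lim]) (use le cost_nonneg[OF c] in auto)
  then have ab: "approximates t (u + v) (\<lambda>n \<tau>. z n \<tau> + y n \<tau>) (\<lambda>n \<tau>. r n \<tau> + s n \<tau>)"
    using c by (auto simp: approximates_def intro!: tendsto_add approximatesD(2)[OF a]
      approximatesD(2)[OF b])
  have "(\<lambda>n. z n t + y n t) \<longlonglongrightarrow> evolution t (u + v)"
    using assms by (intro evolution_lim(1)[OF ab]) (auto intro: subspace_add[OF subspace_H])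
  moreover have "(\<lambda>n. z n t + y n t) \<longlonglongrightarrow> evolution t u + evolution t v"
    using assms by (intro tendsto_add evolution_lim(1)[OF a] evolution_lim(1)[OF b]) auto
  ultimately show ?thesis by (rule LIMSEQ_unique)
qed

lemma evolution_scale:
  assumes "0 \<le> t" "u \<in> H"
  shows "evolution t (a *\<^sub>R u) = a *\<^sub>R evolution t u"
proof -
  obtain z r where b: "approximates t u z r" using ex_approximates assms by blast
  have c: "curve t (\<lambda>\<tau>. a *\<^sub>R z n \<tau>) (\<lambda>\<tau>. a *\<^sub>R r n \<tau>)" for n
    using approximatesD(1)[OF b] by (rule curve_scale)
  have "cost t (\<lambda>\<tau>. a *\<^sub>R r n \<tau>) = a\<^sup>2 * cost t (r n)" for n
    unfolding cost_def by (simp add: power_mult_distrib)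
  moreover have "(\<lambda>n. a\<^sup>2 * cost t (r n)) \<longlonglongrightarrow> a\<^sup>2 * 0"
    by (intro tendsto_intros approximatesD(3)[OF b])
  ultimately have ab: "approximates t (a *\<^sub>R u) (\<lambda>n \<tau>. a *\<^sub>R z n \<tau>) (\<lambda>n \<tau>. a *\<^sub>R r n \<tau>)"
    using c by (auto simp: approximates_def intro!: tendsto_scaleR tendsto_const approximatesD(2)[OF b])
  have "(\<lambda>n. a *\<^sub>R z n t) \<longlonglongrightarrow> evolution t (a *\<^sub>R u)"
    using assms by (intro evolution_lim(1)[OF ab]) (auto intro: subspace_scale[OF subspace_H])
  moreover have "(\<lambda>n. a *\<^sub>R z n t) \<longlonglongrightarrow> a *\<^sub>R evolution t u"
    using assms by (intro tendsto_scaleR tendsto_const evolution_lim(1)[OF b]) auto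
  ultimately show ?thesis by (rule LIMSEQ_unique)
qed

lemma evolution_diff:
  assumes "0 \<le> t" "u \<in> H" "v \<in> H"
  shows "evolution t (u - v) = evolution t u - evolution t v"
  using evolution_add[OF assms(1,2) subspace_neg[OF subspace_H assms(3)]]
    evolution_scale[OF assms(1,3), of "- 1"] by simp

lemma evolution_norm_le:
  assumes "0 \<le> t" "u \<in> H"
  shows "(norm (evolution t u))\<^sup>2 \<le> growth t * (norm u)\<^sup>2"
proof -
  obtain z r where a: "approximates t u z r" using ex_approximates assms by blast
  have "(norm (evolution t u))\<^sup>2 \<le> growth t * ((norm u)\<^sup>2 + 0)"
  proof (rule LIMSEQ_le)
    show "(\<lambda>n. (norm (z n t))\<^sup>2) \<longlonglongrightarrow> (norm (evolution t u))\<^sup>2"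
      using assms by (intro tendsto_intros evolution_lim(1)[OF a]) auto
    show "(\<lambda>n. growth t * ((norm (z n 0))\<^sup>2 + cost t (r n))) \<longlonglongrightarrow> growth t * ((norm u)\<^sup>2 + 0)"
      by (intro tendsto_intros approximatesD(2,3)[OF a])
    show "\<exists>N. \<forall>n\<ge>N. (norm (z n t))\<^sup>2 \<le> growth t * ((norm (z n 0))\<^sup>2 + cost t (r n))"
      using gronwall[OF approximatesD(1)[OF a] \<open>0 \<le> t\<close> order_refl] by blast
  qed
  then show ?thesis by simp
qed

text \<open>Cutting the first \<open>s\<close> time units off an approximating sequence for
  \<open>u\<close> leaves one for \<open>evolution s u\<close>: its initial values
  \<open>z n s\<close> converge by \<open>evolution_lim\<close>.\<close>

lemma evolution_semigroup:
  assumes "0 \<le> s" "0 \<le> t" "u \<in> H"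
  shows "evolution (s + t) u = evolution t (evolution s u)"
proof -
  obtain z r where a: "approximates (s + t) u z r" using ex_approximates[of "s + t" u] assms by auto
  have c: "curve t (\<lambda>\<tau>. z n (s + \<tau>)) (\<lambda>\<tau>. r n (s + \<tau>))" for n
    using approximatesD(1)[OF a] \<open>0 \<le> s\<close> by (rule curve_shift)
  have "(\<lambda>n. cost t (\<lambda>\<tau>. r n (s + \<tau>))) \<longlonglongrightarrow> 0"
    by (rule tendsto_sandwich[OF _ _ tendsto_const approximatesD(3)[OF a]])
      (use cost_shift_le[OF approximatesD(1)[OF a] assms(1,2)] cost_nonneg[OF c] in auto)
  moreover have "(\<lambda>n. z n s) \<longlonglongrightarrow> evolution s u"
    using assms by (intro evolution_lim(1)[OF a]) auto
  ultimately have b: "approximates t (evolution s u) (\<lambda>n \<tau>. z n (s + \<tau>)) (\<lambda>n \<tau>. r n (s + \<tau>))"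
    using c by (simp add: approximates_def)
  show ?thesis
    using LIMSEQ_unique[OF evolution_lim(1)[OF a _ _ \<open>u \<in> H\<close>, of "s + t"]
      evolution_lim(1)[OF b _ _ evolution_in, of t]]
      assms by simp
qed

text \<open>Letting the second index in \<open>approximates_dist_le\<close> tend to infinity gives
  an error bound free of \<open>t\<close>. The uniformity yields continuity in time and, later, the
  exchange of limit and integral.\<close>

lemma evolution_uniform_limit:
  assumes a: "approximates T u z r" and "u \<in> H"
  shows "uniform_limit {0..T} z (\<lambda>t. evolution t u) sequentially"
proof (rule uniform_limitI)
  fix e :: real assume "e > 0"
  have est: "(norm (z n t - evolution t u))\<^sup>2 \<le> growth T * ((norm (z n 0 - u))\<^sup>2 + 2 * cost T (r n))"
    if t: "t \<in> {0..T}" for n t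
  proof -
    have "(norm (z n t - evolution t u))\<^sup>2 \<le> growth T * ((norm (z n 0 - u))\<^sup>2 + 2 * cost T (r n) + 2 * 0)"
    proof (rule LIMSEQ_le)
      show "(\<lambda>m. (norm (z n t - z m t))\<^sup>2) \<longlonglongrightarrow> (norm (z n t - evolution t u))\<^sup>2"
        using t by (intro tendsto_intros evolution_lim(1)[OF a _ _ \<open>u \<in> H\<close>]) auto
      show "(\<lambda>m. growth T * ((norm (z n 0 - z m 0))\<^sup>2 + 2 * cost T (r n) + 2 * cost T (r m)))
          \<longlonglongrightarrow> growth T * ((norm (z n 0 - u))\<^sup>2 + 2 * cost T (r n) + 2 * 0)"
        by (intro tendsto_intros approximatesD(2,3)[OF a])
      show "\<exists>N. \<forall>m\<ge>N. (norm (z n t - z m t))\<^sup>2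
          \<le> growth T * ((norm (z n 0 - z m 0))\<^sup>2 + 2 * cost T (r n) + 2 * cost T (r m))"
        using t approximates_dist_le[OF a a] by auto
    qed
    then show ?thesis by simp
  qed
  have "(\<lambda>n. growth T * ((norm (z n 0 - u))\<^sup>2 + 2 * cost T (r n)))
    \<longlonglongrightarrow> growth T * ((norm (u - u))\<^sup>2 + 2 * 0)"
    by (intro tendsto_intros approximatesD(2,3)[OF a])
  then have "eventually (\<lambda>n. growth T * ((norm (z n 0 - u))\<^sup>2 + 2 * cost T (r n)) < e\<^sup>2) sequentially"
    using \<open>e > 0\<close> by (intro order_tendstoD(2)) auto
  then show "\<forall>\<^sub>F n in sequentially. \<forall>t\<in>{0..T}. dist (z n t) (evolution t u) < e"
  proof eventually_elim
    case (elim n)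
    show ?case
    proof
      fix t assume "t \<in> {0..T}"
      then have "(norm (z n t - evolution t u))\<^sup>2 < e\<^sup>2" using est[of t n] elim by linarith
      then show "dist (z n t) (evolution t u) < e"
        using \<open>e > 0\<close> by (simp add: dist_norm power_less_imp_less_base)
    qed
  qed
qed

lemma evolution_continuous:
  assumes "u \<in> H" shows "continuous_on {0..T} (\<lambda>t. evolution t u)"
proof (cases "T \<ge> 0")
  case True
  then obtain z r where a: "approximates T u z r" using ex_approximates assms by blast
  show ?thesis
    by (rule uniform_limit_theorem[OF _ evolution_uniform_limit[OF a assms]])
      (use curve_continuous[OF approximatesD(1)[OF a]] in auto)
qed auto

text \<open>Supplies the bound, uniform in \<open>n\<close> and \<open>t\<close>, that
  \<open>flipped_pairing_tendsto_zero\<close> requires.\<close>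

lemma approximates_bounded:
  assumes a: "approximates T u z r"
  shows "\<exists>C. \<forall>n. \<forall>t\<in>{0..T}. norm (z n t) \<le> C"
proof -
  have "(\<lambda>n. growth T * ((norm (z n 0))\<^sup>2 + cost T (r n))) \<longlonglongrightarrow> growth T * ((norm u)\<^sup>2 + 0)"
    by (intro tendsto_intros approximatesD(2,3)[OF a])
  then have "Bseq (\<lambda>n. growth T * ((norm (z n 0))\<^sup>2 + cost T (r n)))"
    by (intro convergent_imp_Bseq) (auto simp: convergent_def)
  then obtain K where K: "\<And>n. norm (growth T * ((norm (z n 0))\<^sup>2 + cost T (r n))) \<le> K"
    by (auto simp: Bseq_def)
  have "norm (z n t) \<le> sqrt K" if "t \<in> {0..T}" for n t
  proof -
    have t: "0 \<le> t" "t \<le> T" using that by auto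
    note c = approximatesD(1)[OF a, of n]
    have "(norm (z n t))\<^sup>2 \<le> growth t * ((norm (z n 0))\<^sup>2 + cost t (r n))" using gronwall[OF c t] .
    also have "\<dots> \<le> growth T * ((norm (z n 0))\<^sup>2 + cost T (r n))"
      using cost_mono[OF c t(2)] growth_mono[OF t(2)] cost_nonneg[OF curve_restrict[OF c t(2)]]
        growth_pos[of T]
      by (intro mult_mono) auto
    also have "\<dots> \<le> K" using K[of n] by simp
    finally show ?thesis by (rule real_le_rsqrt)
  qed
  then show ?thesis by blast
qed

lemma evolution_sym:
  assumes "0 \<le> t" "u \<in> H" "v \<in> H"
  shows "inner (evolution t u) v = inner u (evolution t v)"
proof -
  obtain z r where a: "approximates t u z r" using ex_approximates assms by blast
  obtain y s where b: "approximates t v y s" using ex_approximates assms by blast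
  obtain C where C: "\<And>n \<tau>. \<tau> \<in> {0..t} \<Longrightarrow> norm (z n \<tau>) \<le> C" using approximates_bounded[OF a] by blast
  obtain C' where C': "\<And>n \<tau>. \<tau> \<in> {0..t} \<Longrightarrow> norm (y n \<tau>) \<le> C'" using approximates_bounded[OF b] by blast
  \<comment> \<open>The first integral is reflected in time, so that in both integrals the residual
    runs backwards against a uniformly bounded curve; hence both tend to zero.\<close>
  have eq: "inner (z n t) (y n 0) - inner (z n 0) (y n t)
      = integral {0..t} (\<lambda>\<tau>. inner (y n \<tau>) (r n (t - \<tau>))) - integral {0..t}
        (\<lambda>\<tau>. inner (z n \<tau>) (s n (t - \<tau>)))" for n
    using curve_duality[OF \<open>0 \<le> t\<close> approximatesD(1)[OF a] approximatesD(1)[OF b], of n n]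
      integral_flip[of t "\<lambda>\<tau>. inner (r n \<tau>) (y n (t - \<tau>))"] by (simp add: inner_commute)
  have "(\<lambda>n. inner (z n t) (y n 0) - inner (z n 0) (y n t)) \<longlonglongrightarrow> 0 - 0"
    unfolding eq
    by (intro tendsto_diff flipped_pairing_tendsto_zero[OF a \<open>0 \<le> t\<close> _ C']
      flipped_pairing_tendsto_zero[OF b \<open>0 \<le> t\<close> _ C]
      curve_continuous[OF approximatesD(1)[OF a]] curve_continuous[OF approximatesD(1)[OF b]])
  moreover have "(\<lambda>n. inner (z n t) (y n 0) - inner (z n 0) (y n t))
      \<longlonglongrightarrow> inner (evolution t u) v - inner u (evolution t v)"
    using assms by (intro tendsto_intros evolution_lim(1)[OF a] evolution_lim(1)[OF b]
      approximatesD(2)[OF a]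
      approximatesD(2)[OF b]) auto
  ultimately have "inner (evolution t u) v - inner u (evolution t v) = 0"
    using LIMSEQ_unique by fastforce
  then show ?thesis by simp
qed

text \<open>Duality against the constant curve \<open>u\<close>, whose residual is \<open>- A u\<close>, gives the integrated
  equation \<open>(evolution t v - v, u) = \<integral> (evolution s v, A u) ds\<close>; symmetry of \<open>evolution\<close> then puts
  the derivative on \<open>u\<close>.\<close>
lemma evolution_weak_derivative:
  assumes "0 \<le> t" "u \<in> D" "v \<in> H"
    and close: "\<And>s. s \<in> {0..t} \<Longrightarrow> norm (evolution s (A u) - A u) \<le> e"
  shows "\<bar>inner (evolution t u - u - t *\<^sub>R A u) v\<bar> \<le> t * e * norm v"
proof -
  have "u \<in> H" "A u \<in> H" using assms D_subset A_in by auto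
  obtain z r where a: "approximates t v z r" using ex_approximates assms by blast
  have lim0: "(\<lambda>n. integral {0..t} (\<lambda>s. inner u (r n (t - s)))) \<longlonglongrightarrow> 0"
    by (rule flipped_pairing_tendsto_zero[OF a \<open>0 \<le> t\<close>]) auto
  have cont: "continuous_on {0..t} (z n)" "continuous_on {0..t} (r n)" for n
    using approximatesD(1)[OF a] by (auto intro: curve_continuous curve_residual_continuous)
  have eq: "inner (z n t) u - inner (z n 0) u
      = integral {0..t} (\<lambda>s. inner u (r n (t - s))) + integral {0..t} (\<lambda>s. inner (z n s) (A u))" for n
    using curve_duality[OF \<open>0 \<le> t\<close> approximatesD(1)[OF a] curve_const[OF \<open>u \<in> D\<close>], of n]
      integral_flip[of t "\<lambda>s. inner (r n s) u"] by (simp add: inner_commute)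
  have unif: "uniform_limit {0..t} (\<lambda>n s. inner (z n s) (A u)) (\<lambda>s. inner (evolution s v) (A u))
    sequentially"
    by (rule bounded_linear.uniform_limit[OF bounded_linear_inner_left
      evolution_uniform_limit[OF a \<open>v \<in> H\<close>]])
  have lim1: "(\<lambda>n. integral {0..t} (\<lambda>s. inner (z n s) (A u)))
    \<longlonglongrightarrow> integral {0..t} (\<lambda>s. inner (evolution s v) (A u))"
  proof -
    have "continuous_on {0..t} (\<lambda>s. inner (z n s) (A u))" for n
      by (intro continuous_intros cont)
    from uniform_limit_integral[OF unif this] obtain I J
      where IJ: "\<And>n. ((\<lambda>s. inner (z n s) (A u)) has_integral I n) {0..t}"
        "((\<lambda>s. inner (evolution s v) (A u)) has_integral J) {0..t}" "I \<longlonglongrightarrow> J"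
      by auto
    then show ?thesis using integral_unique[OF IJ(1)] integral_unique[OF IJ(2)] by simp
  qed
  have "(\<lambda>n. inner (z n t) u - inner (z n 0) u) \<longlonglongrightarrow> 0 + integral {0..t} (\<lambda>s. inner (evolution s v) (A u))"
    unfolding eq by (intro tendsto_add lim0 lim1)
  moreover have "(\<lambda>n. inner (z n t) u - inner (z n 0) u) \<longlonglongrightarrow> inner (evolution t v) u - inner v u"
    using assms by (intro tendsto_intros evolution_lim(1)[OF a] approximatesD(2)[OF a]) auto
  ultimately have int: "inner (evolution t v) u - inner v u
    = integral {0..t} (\<lambda>s. inner (evolution s v) (A u))"
    using LIMSEQ_unique by fastforce
  have "inner (evolution t u - u - t *\<^sub>R A u) v = inner (evolution t v) u - inner v u - t * inner v (A u)"
    using evolution_sym[OF \<open>0 \<le> t\<close> \<open>u \<in> H\<close> \<open>v \<in> H\<close>] by (simp add: inner_simps inner_commute)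
  also have "\<dots> = integral {0..t} (\<lambda>s. inner (evolution s v) (A u)) - integral {0..t} (\<lambda>s. inner v (A u))"
    using int \<open>0 \<le> t\<close> by simp
  also have "\<dots> = integral {0..t} (\<lambda>s. inner (evolution s v) (A u) - inner v (A u))"
    by (intro integral_diff[symmetric] integrable_continuous_real continuous_intros evolution_continuous
      assms)
  also have "norm \<dots> \<le> integral {0..t} (\<lambda>s. e * norm v)"
  proof (rule integral_norm_bound_integral)
    show "(\<lambda>s. inner (evolution s v) (A u) - inner v (A u)) integrable_on {0..t}"
      by (intro integrable_continuous_real continuous_intros evolution_continuous assms)
    fix s assume s: "s \<in> {0..t}"
    \<comment> \<open>Symmetry moves the evolution from \<open>v\<close> to \<open>A u\<close>, so
      \<open>close\<close> applies whatever \<open>v\<close> is, and the bound is linear in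
      \<open>norm v\<close>.\<close>
    have "inner (evolution s v) (A u) - inner v (A u) = inner v (evolution s (A u) - A u)"
      using evolution_sym[of s v "A u"] s \<open>v \<in> H\<close> \<open>A u \<in> H\<close> by (simp add: inner_diff_right)
    also have "norm \<dots> \<le> norm v * norm (evolution s (A u) - A u)"
      by (simp add: Cauchy_Schwarz_ineq2)
    also have "\<dots> \<le> norm v * e" using close[OF s] by (intro mult_left_mono) auto
    finally show "norm (inner (evolution s v) (A u) - inner v (A u)) \<le> e * norm v"
      by (simp add: mult.commute)
  qed auto
  finally show ?thesis using \<open>0 \<le> t\<close> by (simp add: mult_ac)
qed

text \<open>The bound in \<open>evolution_weak_derivative\<close> is uniform in the direction of the
  test vector. Testing with the error \<open>x\<close> itself and cancelling one factor
  \<open>norm x\<close> turns it into a norm estimate.\<close>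

lemma evolution_derivative:
  assumes "u \<in> D"
  shows "((\<lambda>t. (1 / t) *\<^sub>R (evolution t u - u)) \<longlongrightarrow> A u) (at_right 0)"
proof (rule tendstoI)
  fix e :: real assume "e > 0"
  have "u \<in> H" "A u \<in> H" using assms D_subset A_in by auto
  have "continuous_on {0..1} (\<lambda>t. evolution t (A u))" using evolution_continuous[OF \<open>A u \<in> H\<close>] .
  then have "((\<lambda>t. evolution t (A u)) \<longlongrightarrow> evolution 0 (A u)) (at_right 0)"
    by (rule continuous_on_Icc_at_rightD) simp
  then have "eventually (\<lambda>t. norm (evolution t (A u) - A u) < e / 2) (at_right 0)"
    using tendstoD[of _ _ _ "e / 2"] \<open>e > 0\<close> by (fastforce simp: evolution_0[OF \<open>A u \<in> H\<close>] dist_norm)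
  then obtain b where b: "b > 0" "\<And>t. 0 < t \<Longrightarrow> t < b \<Longrightarrow> norm (evolution t (A u) - A u) < e / 2"
    by (auto simp: eventually_at_right_field)
  have "dist ((1 / t) *\<^sub>R (evolution t u - u)) (A u) < e" if t: "0 < t" "t < b" for t
  proof -
    define x where "x = evolution t u - u - t *\<^sub>R A u"
    have "x \<in> H" unfolding x_def using t
      by (intro subspace_diff[OF subspace_H] subspace_scale[OF subspace_H] evolution_in \<open>u \<in> H\<close> \<open>A u \<in> H\<close>)
        auto
    have "norm (evolution s (A u) - A u) \<le> e / 2" if "s \<in> {0..t}" for s
      using b(2)[of s] that t \<open>e > 0\<close> evolution_0[OF \<open>A u \<in> H\<close>] by (cases "s = 0") auto
    then have "\<bar>inner x x\<bar> \<le> t * (e / 2) * norm x"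
      unfolding x_def by (intro evolution_weak_derivative) (use t assms \<open>x \<in> H\<close> in \<open>auto simp: x_def\<close>)
    then have "norm x * norm x \<le> t * (e / 2) * norm x"
      by (simp add: power2_norm_eq_inner[symmetric] power2_eq_square)
    then have "norm x \<le> t * (e / 2)"
      using t \<open>e > 0\<close> by (cases "norm x = 0") (auto simp: mult_le_cancel_right)
    also have "\<dots> < t * e" using t \<open>e > 0\<close> by simp
    finally have "norm x < t * e" .
    moreover have "(1 / t) *\<^sub>R (evolution t u - u) - A u = (1 / t) *\<^sub>R x"
      using t by (simp add: x_def algebra_simps)
    ultimately show ?thesis using t by (simp add: dist_norm field_simps)
  qed
  then show "eventually (\<lambda>t. dist ((1 / t) *\<^sub>R (evolution t u - u)) (A u) < e) (at_right 0)"
    unfolding eventually_at_right_field using \<open>b > 0\<close> by blast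
qed


end

section \<open>The Hilbert space of square-integrable functions\<close>

lemma sq_integrable_mult:
  assumes "f \<in> sq_integrable M" "g \<in> sq_integrable M"
  shows "integrable M (\<lambda>x. f x * g x)"
proof (rule Bochner_Integration.integrable_bound)
  show "integrable M (\<lambda>x. (f x)\<^sup>2 + (g x)\<^sup>2)" using assms by (auto simp: sq_integrable_def)
  show "(\<lambda>x. f x * g x) \<in> borel_measurable M" using assms by (auto simp: sq_integrable_def)
  show "AE x in M. norm (f x * g x) \<le> norm ((f x)\<^sup>2 + (g x)\<^sup>2)"
  proof (rule AE_I2)
    fix x
    have "2 * (\<bar>f x\<bar> * \<bar>g x\<bar>) \<le> (f x)\<^sup>2 + (g x)\<^sup>2"
      using sum_squares_bound[of "\<bar>f x\<bar>" "\<bar>g x\<bar>"] by simp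
    moreover have "0 \<le> \<bar>f x\<bar> * \<bar>g x\<bar>" by simp
    ultimately have "\<bar>f x\<bar> * \<bar>g x\<bar> \<le> (f x)\<^sup>2 + (g x)\<^sup>2" by linarith
    then show "norm (f x * g x) \<le> norm ((f x)\<^sup>2 + (g x)\<^sup>2)" by (simp add: abs_mult)
  qed
qed

lemma sq_integrable_measurable: "f \<in> sq_integrable M \<Longrightarrow> f \<in> borel_measurable M"
  by (simp add: sq_integrable_def)

lemma sq_integrable_zero [simp]: "(\<lambda>x. 0) \<in> sq_integrable M"
  by (simp add: sq_integrable_def)

lemma sq_integrable_add [intro]:
  assumes "f \<in> sq_integrable M" "g \<in> sq_integrable M"
  shows "(\<lambda>x. f x + g x) \<in> sq_integrable M"
proof -
  have "integrable M (\<lambda>x. (f x)\<^sup>2 + (g x)\<^sup>2 + 2 * (f x * g x))"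
    using assms sq_integrable_mult[OF assms] by (auto simp: sq_integrable_def)
  then show ?thesis using assms by (auto simp: sq_integrable_def power2_sum mult.assoc)
qed

lemma sq_integrable_scale [intro]: "f \<in> sq_integrable M \<Longrightarrow> (\<lambda>x. c * f x) \<in> sq_integrable M"
  by (auto simp: sq_integrable_def power_mult_distrib)

lemma sq_integrable_uminus [intro]: "f \<in> sq_integrable M \<Longrightarrow> (\<lambda>x. - f x) \<in> sq_integrable M"
  by (simp add: sq_integrable_def)

lemma sq_integrable_diff [intro]:
  assumes "f \<in> sq_integrable M" "g \<in> sq_integrable M"
  shows "(\<lambda>x. f x - g x) \<in> sq_integrable M"
  using sq_integrable_add[OF assms(1) sq_integrable_uminus[OF assms(2)]] by simp

section \<open>Operations on classes of square-integrable functions\<close>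

lemma L2_class_eq_iff:
  assumes "f \<in> sq_integrable M" "g \<in> sq_integrable M"
  shows "L2_class M f = L2_class M g \<longleftrightarrow> (AE x in M. f x = g x)"
proof
  assume "L2_class M f = L2_class M g"
  moreover have "g \<in> L2_class M g" using assms by (simp add: L2_class_def L2_rel_def)
  ultimately show "AE x in M. f x = g x" by (auto simp: L2_class_def L2_rel_def)
next
  assume ae: "AE x in M. f x = g x"
  have "(AE x in M. f x = h x) \<longleftrightarrow> (AE x in M. g x = h x)" for h
    using ae by (auto elim: eventually_elim2)
  then show "L2_class M f = L2_class M g"
    using assms by (auto simp: L2_class_def L2_rel_def)
qed

lemma L2_eq: "L2 M = L2_class M ` sq_integrable M"
  by (auto simp: L2_def quotient_def L2_class_def)

lemma L2_class_in: "f \<in> sq_integrable M \<Longrightarrow> L2_class M f \<in> L2 M"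
  by (simp add: L2_eq)

lemma L2_rep_class:
  assumes "f \<in> sq_integrable M"
  shows "L2_rep (L2_class M f) \<in> sq_integrable M" "AE x in M. L2_rep (L2_class M f) x = f x"
proof -
  have "f \<in> L2_class M f" using assms by (simp add: L2_class_def L2_rel_def)
  then have "L2_rep (L2_class M f) \<in> L2_class M f" unfolding L2_rep_def
    by (rule someI[where P = "\<lambda>g. g \<in> L2_class M f"])
  then show "L2_rep (L2_class M f) \<in> sq_integrable M" "AE x in M. L2_rep (L2_class M f) x = f x"
    by (auto simp: L2_class_def L2_rel_def)
qed

lemma L2_rep:
  assumes "u \<in> L2 M"
  shows "L2_rep u \<in> sq_integrable M" "L2_class M (L2_rep u) = u"
proof -
  obtain f where "f \<in> sq_integrable M" "u = L2_class M f" using assms by (auto simp: L2_eq)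
  with L2_rep_class[OF this(1)] show "L2_rep u \<in> sq_integrable M" "L2_class M (L2_rep u) = u"
    by (auto simp: L2_class_eq_iff)
qed

lemma L2_add_class:
  assumes "f \<in> sq_integrable M" "g \<in> sq_integrable M"
  shows "L2_add M (L2_class M f) (L2_class M g) = L2_class M (\<lambda>x. f x + g x)"
  unfolding L2_add_def using L2_rep_class[OF assms(1)] L2_rep_class[OF assms(2)] assms
  by (subst L2_class_eq_iff) auto

lemma L2_diff_class:
  assumes "f \<in> sq_integrable M" "g \<in> sq_integrable M"
  shows "L2_diff M (L2_class M f) (L2_class M g) = L2_class M (\<lambda>x. f x - g x)"
  unfolding L2_diff_def using L2_rep_class[OF assms(1)] L2_rep_class[OF assms(2)] assms
  by (subst L2_class_eq_iff) auto

lemma L2_scale_class: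
  assumes "f \<in> sq_integrable M"
  shows "L2_scale M c (L2_class M f) = L2_class M (\<lambda>x. c * f x)"
  unfolding L2_scale_def using L2_rep_class[OF assms] assms
  by (subst L2_class_eq_iff) auto

lemma L2_inner_class:
  assumes "f \<in> sq_integrable M" "g \<in> sq_integrable M"
  shows "L2_inner M (L2_class M f) (L2_class M g) = (\<integral>x. f x * g x \<partial>M)"
  unfolding L2_inner_def using L2_rep_class[OF assms(1)] L2_rep_class[OF assms(2)] assms
  by (intro integral_cong_AE borel_measurable_times) (auto intro: sq_integrable_measurable)

text \<open>On classes of explicit functions the chosen representatives disappear, so the algebraic
  laws reduce to identities between functions.\<close>

lemmas L2_class_simps = L2_add_class L2_diff_class L2_scale_class L2_inner_class L2_zero_def

lemma L2_add_in [intro]: "u \<in> L2 M \<Longrightarrow> v \<in> L2 M \<Longrightarrow> L2_add M u v \<in> L2 M"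
  by (auto simp: L2_add_def L2_rep intro!: L2_class_in)

lemma L2_diff_in [intro]: "u \<in> L2 M \<Longrightarrow> v \<in> L2 M \<Longrightarrow> L2_diff M u v \<in> L2 M"
  by (auto simp: L2_diff_def L2_rep intro!: L2_class_in)

lemma L2_scale_in [intro]: "u \<in> L2 M \<Longrightarrow> L2_scale M c u \<in> L2 M"
  by (auto simp: L2_scale_def L2_rep intro!: L2_class_in)

lemma L2_zero_in [simp]: "L2_zero M \<in> L2 M"
  by (auto simp: L2_zero_def intro!: L2_class_in)

lemma L2_add_assoc:
  "u \<in> L2 M \<Longrightarrow> v \<in> L2 M \<Longrightarrow> w \<in> L2 M \<Longrightarrow> L2_add M (L2_add M u v) w = L2_add M u (L2_add M v w)"
  by (auto simp: L2_eq L2_class_simps sq_integrable_add add.assoc)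

lemma L2_add_commute: "L2_add M u v = L2_add M v u"
  by (simp add: L2_add_def add.commute)

lemma L2_add_zero: "u \<in> L2 M \<Longrightarrow> L2_add M (L2_zero M) u = u"
  by (auto simp: L2_eq L2_class_simps)

lemma L2_add_scale_minus: "u \<in> L2 M \<Longrightarrow> L2_add M (L2_scale M (- 1) u) u = L2_zero M"
  by (auto simp: L2_eq L2_class_simps sq_integrable_uminus)

lemma L2_diff_eq: "u \<in> L2 M \<Longrightarrow> v \<in> L2 M \<Longrightarrow> L2_diff M u v = L2_add M u (L2_scale M (- 1) v)"
  by (auto simp: L2_eq L2_class_simps sq_integrable_uminus)

lemma L2_scale_add:
  "u \<in> L2 M \<Longrightarrow> v \<in> L2 M \<Longrightarrow> L2_scale M c (L2_add M u v) = L2_add M (L2_scale M c u) (L2_scale M c v)"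
  by (auto simp: L2_eq L2_class_simps sq_integrable_add sq_integrable_scale distrib_left)

lemma L2_scale_add_left:
  "u \<in> L2 M \<Longrightarrow> L2_scale M (a + b) u = L2_add M (L2_scale M a u) (L2_scale M b u)"
  by (auto simp: L2_eq L2_class_simps sq_integrable_scale distrib_right)

lemma L2_scale_scale: "u \<in> L2 M \<Longrightarrow> L2_scale M a (L2_scale M b u) = L2_scale M (a * b) u"
  by (auto simp: L2_eq L2_class_simps sq_integrable_scale mult.assoc)

lemma L2_scale_one: "u \<in> L2 M \<Longrightarrow> L2_scale M 1 u = u"
  by (auto simp: L2_eq L2_class_simps)

lemma L2_scale_zero [simp]: "L2_scale M c (L2_zero M) = L2_zero M"
  by (simp add: L2_class_simps)

lemma L2_inner_commute: "L2_inner M u v = L2_inner M v u"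
  by (simp add: L2_inner_def mult.commute)

lemma L2_inner_add_left:
  "u \<in> L2 M \<Longrightarrow> v \<in> L2 M \<Longrightarrow> w \<in> L2 M \<Longrightarrow> L2_inner M (L2_add M u v) w = L2_inner M u w + L2_inner M v w"
  by (auto simp: L2_eq L2_class_simps sq_integrable_add distrib_right sq_integrable_mult)

lemma L2_inner_scale_left:
  "u \<in> L2 M \<Longrightarrow> v \<in> L2 M \<Longrightarrow> L2_inner M (L2_scale M c u) v = c * L2_inner M u v"
  by (auto simp: L2_eq L2_class_simps sq_integrable_scale mult.assoc)

lemma L2_inner_zero_left [simp]: "u \<in> L2 M \<Longrightarrow> L2_inner M (L2_zero M) u = 0"
  by (auto simp: L2_eq L2_class_simps)

lemma L2_inner_ge_zero: "0 \<le> L2_inner M u u"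
  by (simp add: L2_inner_def)

lemma L2_inner_eq_zero_iff:
  assumes "u \<in> L2 M" shows "L2_inner M u u = 0 \<longleftrightarrow> u = L2_zero M"
proof -
  obtain f where f: "f \<in> sq_integrable M" "u = L2_class M f" using assms by (auto simp: L2_eq)
  have "(\<integral>x. f x * f x \<partial>M) = 0 \<longleftrightarrow> (AE x in M. f x * f x = 0)"
    using sq_integrable_mult[OF f(1) f(1)] by (intro integral_nonneg_eq_0_iff_AE) auto
  then show ?thesis using f by (simp add: L2_class_simps L2_class_eq_iff)
qed

lemma L2_norm_power2: "(L2_norm M u)\<^sup>2 = L2_inner M u u"
  by (simp add: L2_norm_def L2_inner_ge_zero)

text \<open>A rapidly Cauchy subsequence converges almost everywhere because its increments are
  summable there. Fatou's lemma along this subsequence then bounds the distance of every late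
  \<open>f n\<close> to the pointwise limit, so the whole sequence converges.\<close>

lemma L2_Riesz_Fischer:
  fixes f :: "nat \<Rightarrow> 'a \<Rightarrow> real"
  assumes f: "\<And>n. f n \<in> sq_integrable M"
    and cauchy: "\<And>e. e > 0 \<Longrightarrow> \<exists>N. \<forall>m\<ge>N. \<forall>n\<ge>N. (\<integral>x. (f m x - f n x)\<^sup>2 \<partial>M) \<le> e"
  obtains g where "g \<in> sq_integrable M" "(\<lambda>n. \<integral>x. (f n x - g x)\<^sup>2 \<partial>M) \<longlonglongrightarrow> 0"
proof -
  have meas [measurable]: "f n \<in> borel_measurable M" for n using f by (rule sq_integrable_measurable)
  have int: "integrable M (\<lambda>x. (f m x - f n x)\<^sup>2)" for m n
    using sq_integrable_diff[OF f f] by (simp add: sq_integrable_def)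
  have "\<exists>N. \<forall>k. \<forall>m\<ge>N k. \<forall>n\<ge>N k. (\<integral>x. (f m x - f n x)\<^sup>2 \<partial>M) \<le> (1 / 4) ^ k"
    by (intro choice allI cauchy) simp
  then obtain N where N: "\<And>k m n. m \<ge> N k \<Longrightarrow> n \<ge> N k \<Longrightarrow> (\<integral>x. (f m x - f n x)\<^sup>2 \<partial>M) \<le> (1 / 4) ^ k"
    by blast
  \<comment> \<open>The partial sum dominates \<open>N k\<close>, both at \<open>k\<close> and at
    \<open>Suc k\<close>; the added \<open>k\<close> makes \<open>r\<close> tend to
    infinity.\<close>
  define r where "r k = (\<Sum>j\<le>k. N j) + k" for k
  have rN: "r k \<ge> N k" "r (Suc k) \<ge> N k" "r k \<ge> k" for k
  proof -
    have "N k \<le> (\<Sum>j\<le>k. N j)" by (intro member_le_sum) auto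
    then show "r k \<ge> N k" "r (Suc k) \<ge> N k" "r k \<ge> k" by (auto simp: r_def)
  qed
  \<comment> \<open>The squared increments have integrals at most \<open>(1 / 4) ^ k\<close>, so the
    weight \<open>2 ^ k\<close> still leaves a summable series. The weight is what makes the
    increments themselves summable, and not only their squares.\<close>
  define h where "h k x = 2 ^ k * (f (r (Suc k)) x - f (r k) x)\<^sup>2" for k x
  have h_nonneg: "0 \<le> h k x" for k x by (simp add: h_def)
  have h_meas [measurable]: "h k \<in> borel_measurable M" for k unfolding h_def by measurable
  have h_int: "(\<integral>\<^sup>+x. ennreal (h k x) \<partial>M) \<le> ennreal ((1 / 2) ^ k)" for k
  proof -
    have "(\<integral>\<^sup>+x. ennreal (h k x) \<partial>M) = ennreal (\<integral>x. h k x \<partial>M)"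
      by (rule nn_integral_eq_integral) (auto simp: h_def intro!: integrable_mult_right int)
    also have "(\<integral>x. h k x \<partial>M) \<le> 2 ^ k * (1 / 4) ^ k"
      unfolding h_def using N[OF rN(2) rN(1)] by simp
    also have "\<dots> = (1 / 2 :: real) ^ k" by (simp flip: power_mult_distrib)
    finally show ?thesis by (simp add: ennreal_leI)
  qed
  have "(\<integral>\<^sup>+x. (\<Sum>k. ennreal (h k x)) \<partial>M) = (\<Sum>k. \<integral>\<^sup>+x. ennreal (h k x) \<partial>M)"
    by (rule nn_integral_suminf) measurable
  also have "\<dots> \<le> (\<Sum>k. ennreal ((1 / 2) ^ k))"
    by (rule suminf_le) (auto intro: h_int)
  also have "\<dots> = ennreal (\<Sum>k. (1 / 2) ^ k)"
    by (intro suminf_ennreal2) (auto intro: summable_geometric)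
  finally have "(\<integral>\<^sup>+x. (\<Sum>k. ennreal (h k x)) \<partial>M) \<noteq> \<infinity>"
    by (auto simp: top_unique)
  then have "AE x in M. (\<Sum>k. ennreal (h k x)) \<noteq> \<infinity>"
    by (intro nn_integral_PInf_AE) auto
  then have conv: "AE x in M. (\<lambda>k. f (r k) x) \<longlonglongrightarrow> lim (\<lambda>k. f (r k) x)"
  proof eventually_elim
    case (elim x)
    then have "summable (\<lambda>k. h k x)" by (intro summable_suminf_not_top h_nonneg) auto
    then have s: "summable (\<lambda>k. (1 / 2) ^ k + h k x)"
      by (intro summable_add) (auto intro: summable_geometric)
    have "summable (\<lambda>k. f (r (Suc k)) x - f (r k) x)"
    proof (rule summable_comparison_test[OF _ s], intro exI allI impI)
      fix k
      define a :: real where "a = (1 / 2) ^ k"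
      define d where "d = \<bar>f (r (Suc k)) x - f (r k) x\<bar>"
      have "a > 0" by (simp add: a_def)
      have h: "h k x = d\<^sup>2 / a" by (simp add: h_def a_def d_def power_divide)
      \<comment> \<open>Young's inequality: \<open>d * a\<close> is at most the sum of the squares
        of \<open>a\<close> and \<open>d\<close>. Dividing by \<open>a\<close> bounds the increment
        by two summable terms.\<close>
      have "0 \<le> (a - d)\<^sup>2" "0 \<le> a * d" using \<open>a > 0\<close> by (auto simp: d_def)
      then have "d * a \<le> (a + d\<^sup>2 / a) * a" using \<open>a > 0\<close> by (simp add: power2_eq_square algebra_simps)
      then have "d \<le> a + d\<^sup>2 / a" using \<open>a > 0\<close> by (rule mult_right_le_imp_le)
      then show "norm (f (r (Suc k)) x - f (r k) x) \<le> (1 / 2) ^ k + h k x"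
        by (simp add: h[unfolded a_def] a_def d_def)
    qed
    then have "convergent (\<lambda>n. f (r 0) x + (\<Sum>k<n. f (r (Suc k)) x - f (r k) x))"
      by (intro convergent_add convergent_const) (simp add: summable_iff_convergent)
    moreover have "f (r 0) x + (\<Sum>k<n. f (r (Suc k)) x - f (r k) x) = f (r n) x" for n
      using sum_lessThan_telescope[of "\<lambda>k. f (r k) x" n] by simp
    ultimately show ?case by (simp add: convergent_LIMSEQ_iff)
  qed
  \<comment> \<open>Where the subsequence diverges, \<open>lim\<close> returns an unspecified value;
    by \<open>conv\<close> these points are negligible.\<close>
  define g where "g x = lim (\<lambda>k. f (r k) x)" for x
  have g_meas [measurable]: "g \<in> borel_measurable M"
    unfolding g_def by (rule borel_measurable_lim_metric) simp
  have fatou: "(\<integral>\<^sup>+x. ennreal ((f n x - g x)\<^sup>2) \<partial>M) \<le> ennreal e"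
    if e: "e > 0" and n: "n \<ge> K" and K: "\<forall>m\<ge>K. \<forall>n\<ge>K. (\<integral>x. (f m x - f n x)\<^sup>2 \<partial>M) \<le> e" for n K e
  proof -
    have "(\<integral>\<^sup>+x. ennreal ((f n x - g x)\<^sup>2) \<partial>M) \<le> (\<integral>\<^sup>+x. liminf (\<lambda>k. ennreal ((f n x - f (r k) x)\<^sup>2)) \<partial>M)"
      using conv
    proof (intro nn_integral_mono_AE, eventually_elim)
      case (elim x)
      have "(\<lambda>k. ennreal ((f n x - f (r k) x)\<^sup>2)) \<longlonglongrightarrow> ennreal ((f n x - g x)\<^sup>2)"
        using elim by (intro tendsto_ennrealI tendsto_intros) (simp add: g_def)
      then show ?case using lim_imp_Liminf[OF sequentially_bot] by fastforce
    qed
    also have "\<dots> \<le> liminf (\<lambda>k. \<integral>\<^sup>+x. ennreal ((f n x - f (r k) x)\<^sup>2) \<partial>M)"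
      by (rule nn_integral_liminf) measurable
    also have "\<dots> \<le> ennreal e"
    proof (rule Liminf_le)
      have "\<integral>\<^sup>+x. ennreal ((f n x - f (r k) x)\<^sup>2) \<partial>M \<le> ennreal e" if "k \<ge> K" for k
      proof -
        have "(\<integral>\<^sup>+x. ennreal ((f n x - f (r k) x)\<^sup>2) \<partial>M) = ennreal (\<integral>x. (f n x - f (r k) x)\<^sup>2 \<partial>M)"
          by (rule nn_integral_eq_integral[OF int]) auto
        also have "\<dots> \<le> ennreal e" using K n that rN(3)[of k] by (intro ennreal_leI) auto
        finally show ?thesis .
      qed
      then show "\<forall>\<^sub>F k in sequentially. \<integral>\<^sup>+x. ennreal ((f n x - f (r k) x)\<^sup>2) \<partial>M \<le> ennreal e"
        by (auto simp: eventually_sequentially)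
    qed simp
    finally show ?thesis .
  qed
  obtain K where K: "\<forall>m\<ge>K. \<forall>n\<ge>K. (\<integral>x. (f m x - f n x)\<^sup>2 \<partial>M) \<le> 1" using cauchy[of 1] by auto
  \<comment> \<open>\<open>g\<close> is square-integrable because it differs from \<open>f K\<close>
    by a function whose square has integral at most 1.\<close>
  have "(\<lambda>x. f K x - g x) \<in> sq_integrable M"
    using fatou[OF _ order_refl K] le_less_trans[OF _ ennreal_less_top[of 1]]
    by (auto simp: sq_integrable_def integrable_iff_bounded)
  from sq_integrable_diff[OF f[of K] this] have g: "g \<in> sq_integrable M" by simp
  have gint: "integrable M (\<lambda>x. (f n x - g x)\<^sup>2)" for n
    using sq_integrable_diff[OF f g] by (simp add: sq_integrable_def)
  have "(\<lambda>n. \<integral>x. (f n x - g x)\<^sup>2 \<partial>M) \<longlonglongrightarrow> 0"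
  proof (rule LIMSEQ_I)
    fix e :: real assume "e > 0"
    then obtain K where K: "\<forall>m\<ge>K. \<forall>n\<ge>K. (\<integral>x. (f m x - f n x)\<^sup>2 \<partial>M) \<le> e / 2" using cauchy[of "e / 2"]
      by auto
    have "(\<integral>x. (f n x - g x)\<^sup>2 \<partial>M) < e" if "n \<ge> K" for n
    proof -
      have "ennreal (\<integral>x. (f n x - g x)\<^sup>2 \<partial>M) \<le> ennreal (e / 2)"
        using fatou[OF _ that K] \<open>e > 0\<close> nn_integral_eq_integral[OF gint, of n] by simp
      then show ?thesis using \<open>e > 0\<close> by simp
    qed
    then show "\<exists>K. \<forall>n\<ge>K. norm ((\<integral>x. (f n x - g x)\<^sup>2 \<partial>M) - 0) < e" by auto
  qed
  with g show ?thesis by (rule that)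
qed

text \<open>
  A type cannot depend on the measure, so the spaces \<open>L\<^sup>2\<close> of all measures are placed side by side in
  one inner product space, their algebraic direct sum. It is not complete, but each summand is.
\<close>

typedef 'a l2_sum = "{F :: 'a measure \<Rightarrow> 'a l2. (\<forall>N. F N \<in> L2 N) \<and> finite {N. F N \<noteq> L2_zero N}}"
  morphisms component Abs_l2_sum
  by (rule exI[of _ L2_zero]) simp

lemma component_in [simp]: "component F N \<in> L2 N"
  using component[of F] by simp

lemma finite_support: "finite {N. component F N \<noteq> L2_zero N}"
  using component[of F] by simp

lemma component_Abs:
  assumes "\<And>N. F N \<in> L2 N" "finite S" "\<And>N. N \<notin> S \<Longrightarrow> F N = L2_zero N"
  shows "component (Abs_l2_sum F) = F"
proof (rule Abs_l2_sum_inverse)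
  have "{N. F N \<noteq> L2_zero N} \<subseteq> S" using assms(3) by auto
  then show "F \<in> {F. (\<forall>N. F N \<in> L2 N) \<and> finite {N. F N \<noteq> L2_zero N}}"
    using assms(1,2) finite_subset by auto
qed

lemma l2_sum_eqI: "(\<And>N. component F N = component G N) \<Longrightarrow> F = G"
  by (simp add: component_inject[symmetric] fun_eq_iff)

instantiation l2_sum :: (type) real_inner
begin

definition zero_l2_sum :: "'a l2_sum" where
  "zero_l2_sum = Abs_l2_sum L2_zero"

definition plus_l2_sum :: "'a l2_sum \<Rightarrow> 'a l2_sum \<Rightarrow> 'a l2_sum" where
  "plus_l2_sum F G = Abs_l2_sum (\<lambda>N. L2_add N (component F N) (component G N))"

definition scaleR_l2_sum :: "real \<Rightarrow> 'a l2_sum \<Rightarrow> 'a l2_sum" where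
  "scaleR_l2_sum c F = Abs_l2_sum (\<lambda>N. L2_scale N c (component F N))"

definition uminus_l2_sum :: "'a l2_sum \<Rightarrow> 'a l2_sum" where
  "uminus_l2_sum F = (- 1) *\<^sub>R F"

definition minus_l2_sum :: "'a l2_sum \<Rightarrow> 'a l2_sum \<Rightarrow> 'a l2_sum" where
  "minus_l2_sum F G = F + - G"

definition inner_l2_sum :: "'a l2_sum \<Rightarrow> 'a l2_sum \<Rightarrow> real" where
  "inner_l2_sum F G = (\<Sum>N | component F N \<noteq> L2_zero N. L2_inner N (component F N) (component G N))"

definition norm_l2_sum :: "'a l2_sum \<Rightarrow> real" where
  "norm_l2_sum F = sqrt (inner F F)"

definition sgn_l2_sum :: "'a l2_sum \<Rightarrow> 'a l2_sum" where
  "sgn_l2_sum F = inverse (norm F) *\<^sub>R F"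

definition dist_l2_sum :: "'a l2_sum \<Rightarrow> 'a l2_sum \<Rightarrow> real" where
  "dist_l2_sum F G = norm (F - G)"

definition uniformity_l2_sum :: "('a l2_sum \<times> 'a l2_sum) filter" where
  "uniformity_l2_sum = (INF e\<in>{0 <..}. principal {(F, G). dist F G < e})"

definition open_l2_sum :: "'a l2_sum set \<Rightarrow> bool" where
  "open_l2_sum U = (\<forall>F\<in>U. eventually (\<lambda>(F', G). F' = F \<longrightarrow> G \<in> U) uniformity)"

lemma component_zero: "component (0 :: 'a l2_sum) N = L2_zero N"
  unfolding zero_l2_sum_def by (subst component_Abs[of _ "{}"]) auto

lemma component_plus: "component (F + G :: 'a l2_sum) N = L2_add N (component F N) (component G N)"
  unfolding plus_l2_sum_def
  by (subst component_Abs[OF _ finite_UnI[OF finite_support[of F] finite_support[of G]]])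
    (auto intro!: L2_add_in simp: L2_add_zero)

lemma component_scaleR: "component (c *\<^sub>R F :: 'a l2_sum) N = L2_scale N c (component F N)"
  unfolding scaleR_l2_sum_def
  by (subst component_Abs[OF _ finite_support[of F]]) auto

text \<open>The index set in \<open>inner_l2_sum\<close> depends on the first argument. Over a
  common finite superset the extra terms are zero, so additivity and symmetry can be read off term
  by term.\<close>

lemma inner_l2_sum_superset:
  assumes "finite S" "{N. component F N \<noteq> L2_zero N} \<subseteq> S"
  shows "inner F G = (\<Sum>N\<in>S. L2_inner N (component F N) (component G N))"
  unfolding inner_l2_sum_def using assms by (intro sum.mono_neutral_left) auto

instance
proof
  fix F G K :: "'a l2_sum" and a b :: real
  note comps = component_zero component_plus component_scaleR
  show "F + G + K = F + (G + K)"
    by (rule l2_sum_eqI) (simp add: comps L2_add_assoc)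
  show "F + G = G + F"
    by (rule l2_sum_eqI) (simp add: comps L2_add_commute)
  show "0 + F = F"
    by (rule l2_sum_eqI) (simp add: comps L2_add_zero)
  show "- F + F = 0"
    by (rule l2_sum_eqI) (simp add: uminus_l2_sum_def comps L2_add_scale_minus)
  show "F - G = F + - G" by (simp add: minus_l2_sum_def)
  show "a *\<^sub>R (F + G) = a *\<^sub>R F + a *\<^sub>R G"
    by (rule l2_sum_eqI) (simp add: comps L2_scale_add)
  show "(a + b) *\<^sub>R F = a *\<^sub>R F + b *\<^sub>R F"
    by (rule l2_sum_eqI) (simp add: comps L2_scale_add_left)
  show "a *\<^sub>R b *\<^sub>R F = (a * b) *\<^sub>R F"
    by (rule l2_sum_eqI) (simp add: comps L2_scale_scale)
  show "1 *\<^sub>R F = F"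
    by (rule l2_sum_eqI) (simp add: comps L2_scale_one)
  show "dist F G = norm (F - G)" by (simp add: dist_l2_sum_def)
  show "sgn F = inverse (norm F) *\<^sub>R F" by (simp add: sgn_l2_sum_def)
  show "uniformity = (INF e\<in>{0 <..}. principal {(F, G). dist (F :: 'a l2_sum) G < e})"
    by (simp add: uniformity_l2_sum_def)
  show "open U = (\<forall>F\<in>U. \<forall>\<^sub>F (F', G) in uniformity. F' = F \<longrightarrow> G \<in> U)" for U :: "'a l2_sum set"
    by (simp add: open_l2_sum_def)
  \<comment> \<open>One finite set that contains the supports of all vectors whose inner products
    the axioms compare.\<close>
  define S where "S = {N. component F N \<noteq> L2_zero N} \<union> {N. component G N \<noteq> L2_zero N}
    \<union> {N. component (F + G) N \<noteq> L2_zero N} \<union> {N. component (a *\<^sub>R F) N \<noteq> L2_zero N}"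
  have S: "finite S" unfolding S_def by (intro finite_UnI finite_support)
  have inner_S: "inner X Y = (\<Sum>N\<in>S. L2_inner N (component X N) (component Y N))"
    if "X \<in> {F, G, F + G, a *\<^sub>R F}" for X Y
    using that S by (intro inner_l2_sum_superset) (auto simp: S_def)
  show "inner F G = inner G F" by (simp add: inner_S L2_inner_commute)
  show "inner (F + G) K = inner F K + inner G K"
    by (simp add: inner_S comps L2_inner_add_left sum.distrib)
  show "inner (a *\<^sub>R F) G = a * inner F G"
    by (simp add: inner_S comps L2_inner_scale_left sum_distrib_left)
  show "0 \<le> inner F F" by (simp add: inner_l2_sum_def sum_nonneg L2_inner_ge_zero)
  show "inner F F = 0 \<longleftrightarrow> F = 0"
  proof
    assume "inner F F = 0"
    then have "\<forall>N\<in>{N. component F N \<noteq> L2_zero N}. L2_inner N (component F N) (component F N) = 0"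
      unfolding inner_l2_sum_def by (subst (asm) sum_nonneg_eq_0_iff)
        (auto simp: finite_support L2_inner_ge_zero)
    then show "F = 0" by (intro l2_sum_eqI) (auto simp: L2_inner_eq_zero_iff comps)
  qed (simp add: inner_l2_sum_def comps)
  show "norm F = sqrt (inner F F)" by (simp add: norm_l2_sum_def)
qed

end

section \<open>The summand of a single measure\<close>

definition l2_embed :: "'a measure \<Rightarrow> 'a l2 \<Rightarrow> 'a l2_sum" where
  "l2_embed M u = Abs_l2_sum (\<lambda>N. if N = M then u else L2_zero N)"

lemma component_embed:
  "u \<in> L2 M \<Longrightarrow> component (l2_embed M u) N = (if N = M then u else L2_zero N)"
  unfolding l2_embed_def by (subst component_Abs[of _ "{M}"]) auto

lemma component_embed_same [simp]: "u \<in> L2 M \<Longrightarrow> component (l2_embed M u) M = u"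
  by (simp add: component_embed)

lemma embed_component: "x \<in> l2_embed M ` L2 M \<Longrightarrow> l2_embed M (component x M) = x"
  by auto

lemma embed_add:
  "u \<in> L2 M \<Longrightarrow> v \<in> L2 M \<Longrightarrow> l2_embed M (L2_add M u v) = l2_embed M u + l2_embed M v"
  by (rule l2_sum_eqI) (auto simp: component_embed component_plus L2_add_in L2_add_zero)

lemma embed_scale: "u \<in> L2 M \<Longrightarrow> l2_embed M (L2_scale M c u) = c *\<^sub>R l2_embed M u"
  by (rule l2_sum_eqI) (auto simp: component_embed component_scaleR L2_scale_in)

lemma embed_zero: "l2_embed M (L2_zero M) = 0"
  by (rule l2_sum_eqI) (auto simp: component_embed component_zero)

lemma embed_diff:
  "u \<in> L2 M \<Longrightarrow> v \<in> L2 M \<Longrightarrow> l2_embed M (L2_diff M u v) = l2_embed M u - l2_embed M v"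
  by (simp add: L2_diff_eq embed_add embed_scale L2_scale_in)

lemma inner_embed:
  "u \<in> L2 M \<Longrightarrow> v \<in> L2 M \<Longrightarrow> inner (l2_embed M u) (l2_embed M v) = L2_inner M u v"
  by (subst inner_l2_sum_superset[of "{M}"]) (auto simp: component_embed)

lemma norm_embed: "u \<in> L2 M \<Longrightarrow> norm (l2_embed M u) = L2_norm M u"
  by (simp add: norm_eq_sqrt_inner inner_embed L2_norm_def)

lemma dist_embed: "u \<in> L2 M \<Longrightarrow> v \<in> L2 M \<Longrightarrow> norm (l2_embed M u - l2_embed M v) = L2_dist M u v"
  by (simp add: L2_dist_def norm_embed L2_diff_in flip: embed_diff)

lemma embed_inject: "u \<in> L2 M \<Longrightarrow> v \<in> L2 M \<Longrightarrow> l2_embed M u = l2_embed M v \<longleftrightarrow> u = v"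
  by (metis component_embed_same)

lemma subspace_embed: "L2_subspace M V \<Longrightarrow> subspace (l2_embed M ` V)"
  unfolding subspace_def
proof (intro conjI ballI allI)
  assume V: "L2_subspace M V"
  then have sub: "u \<in> V \<Longrightarrow> u \<in> L2 M" for u by (auto simp: L2_subspace_def)
  show "0 \<in> l2_embed M ` V" using V by (auto simp: L2_subspace_def simp flip: embed_zero[of M])
  fix x assume "x \<in> l2_embed M ` V"
  then obtain u where u: "u \<in> V" "x = l2_embed M u" by auto
  show "c *\<^sub>R x \<in> l2_embed M ` V" for c
    using u V sub by (auto simp: L2_subspace_def simp flip: embed_scale)
  fix y assume "y \<in> l2_embed M ` V"
  then obtain v where v: "v \<in> V" "y = l2_embed M v" by auto
  show "x + y \<in> l2_embed M ` V"
    using u v V sub by (auto simp: L2_subspace_def simp flip: embed_add)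
qed

lemma L2_subspace_L2: "L2_subspace M (L2 M)"
  by (auto simp: L2_subspace_def)

lemma dist_embed_class:
  assumes "f \<in> sq_integrable M" "g \<in> sq_integrable M"
  shows "(norm (l2_embed M (L2_class M f) - l2_embed M (L2_class M g)))\<^sup>2 = (\<integral>x. (f x - g x)\<^sup>2 \<partial>M)"
  using assms sq_integrable_diff[OF assms]
  by (simp add: dist_embed L2_class_in L2_dist_def L2_norm_power2 L2_class_simps)
    (simp add: power2_eq_square)

lemma complete_embed: "complete (l2_embed M ` L2 M)"
proof (rule completeI)
  fix x assume x: "\<forall>n. x n \<in> l2_embed M ` L2 M" and "Cauchy x"
  define f where "f n = L2_rep (component (x n) M)" for n
  have f: "f n \<in> sq_integrable M" for n by (simp add: f_def L2_rep)
  have xf: "x n = l2_embed M (L2_class M (f n))" for n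
    using x by (simp add: f_def L2_rep embed_component)
  have "\<exists>N. \<forall>m\<ge>N. \<forall>n\<ge>N. (\<integral>x. (f m x - f n x)\<^sup>2 \<partial>M) \<le> e" if "e > 0" for e
  proof -
    obtain N where N: "\<forall>m\<ge>N. \<forall>n\<ge>N. norm (x m - x n) < sqrt e"
      using \<open>Cauchy x\<close> \<open>e > 0\<close> unfolding Cauchy_iff by (meson real_sqrt_gt_zero)
    have "(\<integral>x. (f m x - f n x)\<^sup>2 \<partial>M) \<le> e" if "m \<ge> N" "n \<ge> N" for m n
    proof -
      have "(norm (x m - x n))\<^sup>2 \<le> (sqrt e)\<^sup>2" using N that
        by (intro power_mono) (auto intro: less_imp_le)
      then show ?thesis using \<open>e > 0\<close> by (simp add: xf dist_embed_class[OF f f])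
    qed
    then show ?thesis by blast
  qed
  then obtain g where g: "g \<in> sq_integrable M" "(\<lambda>n. \<integral>x. (f n x - g x)\<^sup>2 \<partial>M) \<longlonglongrightarrow> 0"
    by (rule L2_Riesz_Fischer[OF f])
  have "(\<lambda>n. (norm (x n - l2_embed M (L2_class M g)))\<^sup>2) \<longlonglongrightarrow> 0"
    using g(2) by (simp add: xf dist_embed_class[OF f g(1)])
  then have "(\<lambda>n. sqrt ((norm (x n - l2_embed M (L2_class M g)))\<^sup>2)) \<longlonglongrightarrow> sqrt 0" by (rule tendsto_real_sqrt)
  then have "x \<longlonglongrightarrow> l2_embed M (L2_class M g)" by (simp add: tendsto_norm_zero_iff LIM_zero_iff)
  then show "\<exists>l\<in>l2_embed M ` L2 M. x \<longlonglongrightarrow> l" using g(1) by (auto intro: L2_class_in)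
qed

section \<open>Approximate solutions from density in space-time\<close>

text \<open>A total function on the sum type. It is meaningful only on the embedded domain of
  \<open>L\<close>, and the locale restricts its assumptions about \<open>A\<close>
  accordingly.\<close>

definition embedded_op :: "'a measure \<Rightarrow> 'a l2_op \<Rightarrow> 'a l2_sum \<Rightarrow> 'a l2_sum" where
  "embedded_op M L x = l2_embed M (the (L (component x M)))"

lemma L2_linear_operatorD:
  assumes "L2_linear_operator M L"
  shows "L2_subspace M (dom L)" "u \<in> dom L \<Longrightarrow> u \<in> L2 M" "u \<in> dom L \<Longrightarrow> the (L u) \<in> L2 M"
    "u \<in> dom L \<Longrightarrow> v \<in> dom L \<Longrightarrow> the (L (L2_add M u v)) = L2_add M (the (L u)) (the (L v))"
    "u \<in> dom L \<Longrightarrow> the (L (L2_scale M c u)) = L2_scale M c (the (L u))"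
  using assms by (auto simp: L2_linear_operator_def L2_subspace_def ran_def)

lemma embedded_op_embed:
  "L2_linear_operator M L \<Longrightarrow> u \<in> dom L \<Longrightarrow> embedded_op M L (l2_embed M u) = l2_embed M (the (L u))"
  using L2_linear_operatorD(2)[of M L u] by (simp add: embedded_op_def)

lemma embedded_op_add:
  assumes L: "L2_linear_operator M L" and "x \<in> l2_embed M ` dom L" "y \<in> l2_embed M ` dom L"
  shows "embedded_op M L (x + y) = embedded_op M L x + embedded_op M L y"
proof -
  obtain u v where uv: "u \<in> dom L" "x = l2_embed M u" "v \<in> dom L" "y = l2_embed M v" using assms by auto
  note D = L2_linear_operatorD[OF L]
  have "L2_add M u v \<in> dom L" using uv D(1) by (simp add: L2_subspace_def)
  then show ?thesis
    using uv embedded_op_embed[OF L] D by (simp flip: embed_add)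
qed

lemma embedded_op_scale:
  assumes L: "L2_linear_operator M L" and "x \<in> l2_embed M ` dom L"
  shows "embedded_op M L (c *\<^sub>R x) = c *\<^sub>R embedded_op M L x"
proof -
  obtain u where u: "u \<in> dom L" "x = l2_embed M u" using assms by auto
  note D = L2_linear_operatorD[OF L]
  have "L2_scale M c u \<in> dom L" using u D(1) by (simp add: L2_subspace_def)
  then show ?thesis
    using u embedded_op_embed[OF L] D by (simp flip: embed_scale)
qed

lemma embedded_op_in:
  "L2_linear_operator M L \<Longrightarrow> x \<in> l2_embed M ` dom L \<Longrightarrow> embedded_op M L x \<in> l2_embed M ` L2 M"
  by (erule imageE) (simp add: embedded_op_embed L2_linear_operatorD(3) imageI)

section \<open>Integration over space-time\<close>

lemma continuous_on_measurable_time: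
  assumes "continuous_on {0..T} f"
  shows "f \<in> borel_measurable (restrict_space lborel {0..T :: real})"
  using borel_measurable_continuous_on_restrict[OF assms]
  by (simp cong: measurable_cong_sets add: sets_restrict_space)

lemma sigma_finite_time: "sigma_finite_measure (restrict_space lborel {0..T :: real})"
  by (rule finite_measure.axioms(1), rule finite_measureI)
    (simp add: emeasure_restrict_space space_restrict_space emeasure_lborel_Icc_eq)

lemma pair_sigma_finite_spacetime:
  "sigma_finite_measure M \<Longrightarrow> pair_sigma_finite (restrict_space lborel {0..T :: real}) M"
  by (intro pair_sigma_finite.intro sigma_finite_time)

lemma sq_integrable_tensor:
  assumes M: "sigma_finite_measure M" and f: "continuous_on {0..T} f" and p: "p \<in> sq_integrable M"
  shows "(\<lambda>(t, x). f t * p x) \<in> sq_integrable (spacetime T M)"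
proof -
  interpret pair_sigma_finite "restrict_space lborel {0..T}" M
    using pair_sigma_finite_spacetime[OF M] .
  have [measurable]: "f \<in> borel_measurable (restrict_space lborel {0..T})" "p \<in> borel_measurable M"
    using continuous_on_measurable_time[OF f] p by (auto simp: sq_integrable_def)
  have meas: "(\<lambda>(t, x). f t * p x) \<in> borel_measurable (spacetime T M)"
    unfolding spacetime_def by measurable
  have p2: "integrable M (\<lambda>x. (p x)\<^sup>2)" using p by (simp add: sq_integrable_def)
  have "set_integrable lborel {0..T} (\<lambda>t. (f t)\<^sup>2)"
    by (intro borel_integrable_atLeastAtMost' continuous_intros f)
  then have f2: "integrable (restrict_space lborel {0..T}) (\<lambda>t. (f t)\<^sup>2)"
    by (simp add: integrable_restrict_space set_integrable_def)
  have "integrable (restrict_space lborel {0..T} \<Otimes>\<^sub>M M) (\<lambda>(t, x). (f t * p x)\<^sup>2)"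
  proof (rule Fubini_integrable)
    show "(\<lambda>(t, x). (f t * p x)\<^sup>2) \<in> borel_measurable (restrict_space lborel {0..T} \<Otimes>\<^sub>M M)" by measurable
    show "integrable (restrict_space lborel {0..T})
      (\<lambda>t. \<integral>x. norm (case (t, x) of (t, x) \<Rightarrow> (f t * p x)\<^sup>2) \<partial>M)"
      using f2 by (simp add: power_mult_distrib)
    show "AE t in restrict_space lborel {0..T}. integrable M (\<lambda>x. case (t, x) of (t, x) \<Rightarrow> (f t * p x)\<^sup>2)"
      using p2 by (simp add: power_mult_distrib)
  qed
  then show ?thesis
    using meas by (simp add: sq_integrable_def spacetime_def case_prod_unfold)
qed

text \<open>Fubini, with the outer Lebesgue integral converted into the Henstock-Kurzweil integral
  in which \<open>cost\<close> is written.\<close>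

lemma spacetime_integral:
  assumes M: "sigma_finite_measure M" and G: "G \<in> sq_integrable (spacetime T M)"
  shows "(\<integral>z. (G z)\<^sup>2 \<partial>spacetime T M) = integral {0..T} (\<lambda>t. \<integral>x. (G (t, x))\<^sup>2 \<partial>M)"
proof -
  interpret pair_sigma_finite "restrict_space lborel {0..T}" M
    using pair_sigma_finite_spacetime[OF M] .
  have int: "integrable (restrict_space lborel {0..T} \<Otimes>\<^sub>M M) (\<lambda>(t, x). (G (t, x))\<^sup>2)"
    using G by (simp add: sq_integrable_def spacetime_def case_prod_unfold)
  have "set_integrable lborel {0..T} (\<lambda>t. \<integral>x. (G (t, x))\<^sup>2 \<partial>M)"
    using integrable_fst[OF int] by (simp add: integrable_restrict_space set_integrable_def)
  then have "(LINT t:{0..T}|lborel. (\<integral>x. (G (t, x))\<^sup>2 \<partial>M)) = integral {0..T} (\<lambda>t. \<integral>x. (G (t, x))\<^sup>2 \<partial>M)"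
    by (rule set_borel_integral_eq_integral)
  moreover have "(\<integral>t. (\<integral>x. (G (t, x))\<^sup>2 \<partial>M) \<partial>restrict_space lborel {0..T})
      = (LINT t:{0..T}|lborel. (\<integral>x. (G (t, x))\<^sup>2 \<partial>M))"
    by (simp add: integral_restrict_space set_lebesgue_integral_def)
  ultimately show ?thesis using integral_fst'[OF int] by (simp add: spacetime_def case_prod_unfold)
qed

text \<open>\<open>g\<close> represents \<open>(\<partial>\<^sub>t + L) w\<close> for a \<open>C\<^sup>1\<close> curve \<open>w\<close> in the domain of \<open>L\<close> with \<open>w T = 0\<close>;
  in contrast to the tensors these functions form a subspace.\<close>
definition curve_rep ::
  "real \<Rightarrow> 'a measure \<Rightarrow> 'a l2_op \<Rightarrow> (real \<times> 'a \<Rightarrow> real) \<Rightarrow> (real \<Rightarrow> 'a l2_sum) \<Rightarrow> (real \<Rightarrow> 'a l2_sum) \<Rightarrow> bool"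
where
  "curve_rep T M L g w w' \<longleftrightarrow>
     g \<in> sq_integrable (spacetime T M) \<and> w T = 0 \<and> continuous_on {0..T} w'
     \<and> continuous_on {0..T} (\<lambda>t. embedded_op M L (w t))
     \<and> (\<forall>t\<in>{0..T}. w t \<in> l2_embed M ` dom L \<and> (w has_vector_derivative w' t) (at t within {0..T})
         \<and> (\<lambda>x. g (t, x)) \<in> sq_integrable M
         \<and> l2_embed M (L2_class M (\<lambda>x. g (t, x))) = w' t + embedded_op M L (w t))"

lemma curve_repD:
  assumes "curve_rep T M L g w w'"
  shows "g \<in> sq_integrable (spacetime T M)" "w T = 0" "continuous_on {0..T} w'"
    "continuous_on {0..T} (\<lambda>t. embedded_op M L (w t))"
    "t \<in> {0..T} \<Longrightarrow> w t \<in> l2_embed M ` dom L"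
    "t \<in> {0..T} \<Longrightarrow> (w has_vector_derivative w' t) (at t within {0..T})"
    "t \<in> {0..T} \<Longrightarrow> (\<lambda>x. g (t, x)) \<in> sq_integrable M"
    "t \<in> {0..T} \<Longrightarrow> l2_embed M (L2_class M (\<lambda>x. g (t, x))) = w' t + embedded_op M L (w t)"
  using assms by (simp_all add: curve_rep_def)

definition curve_image :: "real \<Rightarrow> 'a measure \<Rightarrow> 'a l2_op \<Rightarrow> (real \<times> 'a) l2 set" where
  "curve_image T M L = {L2_class (spacetime T M) g | g w w'. curve_rep T M L g w w'}"

lemma curve_imageI:
  assumes "g \<in> sq_integrable (spacetime T M)" "w T = 0" "continuous_on {0..T} w'"
    "continuous_on {0..T} (\<lambda>t. embedded_op M L (w t))"
    "\<And>t. t \<in> {0..T} \<Longrightarrow> w t \<in> l2_embed M ` dom L"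
    "\<And>t. t \<in> {0..T} \<Longrightarrow> (w has_vector_derivative w' t) (at t within {0..T})"
    "\<And>t. t \<in> {0..T} \<Longrightarrow> (\<lambda>x. g (t, x)) \<in> sq_integrable M"
    "\<And>t. t \<in> {0..T} \<Longrightarrow> l2_embed M (L2_class M (\<lambda>x. g (t, x))) = w' t + embedded_op M L (w t)"
  shows "L2_class (spacetime T M) g \<in> curve_image T M L"
proof -
  have "curve_rep T M L g w w'" unfolding curve_rep_def using assms by (intro conjI ballI)
  then show ?thesis unfolding curve_image_def by blast
qed

lemma embed_class_add:
  "f \<in> sq_integrable M \<Longrightarrow> g \<in> sq_integrable M \<Longrightarrow>
    l2_embed M (L2_class M (\<lambda>x. f x + g x)) = l2_embed M (L2_class M f) + l2_embed M (L2_class M g)"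
  by (simp add: L2_class_in flip: L2_add_class embed_add)

lemma embed_class_scale:
  "f \<in> sq_integrable M \<Longrightarrow> l2_embed M (L2_class M (\<lambda>x. c * f x)) = c *\<^sub>R l2_embed M (L2_class M f)"
  by (simp add: L2_class_in flip: L2_scale_class embed_scale)

text \<open>Since the span is a hull, this puts it inside \<open>curve_image\<close>: every element
  of the span comes with a curve, and no finite sums of tensors have to be handled.\<close>

lemma L2_subspace_curve_image:
  assumes L: "L2_linear_operator M L"
  shows "L2_subspace (spacetime T M) (curve_image T M L)"
proof -
  note D = L2_linear_operatorD[OF L]
  have sub: "subspace (l2_embed M ` dom L)" by (rule subspace_embed[OF D(1)])
  have zero: "embedded_op M L 0 = 0"
    using embedded_op_scale[OF L, of 0 0] subspace_0[OF sub] by simp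
  have "U \<in> L2 (spacetime T M)" if "U \<in> curve_image T M L" for U
    using that by (auto simp: curve_image_def intro: L2_class_in curve_repD(1))
  moreover have "L2_zero (spacetime T M) \<in> curve_image T M L"
    unfolding L2_zero_def
    by (rule curve_imageI[where w = "\<lambda>_. 0" and w' = "\<lambda>_. 0"])
      (use subspace_0[OF sub] in \<open>auto simp: zero embed_zero[unfolded L2_zero_def]\<close>)
  moreover have "L2_add (spacetime T M) U V \<in> curve_image T M L"
    if U: "U \<in> curve_image T M L" and V: "V \<in> curve_image T M L" for U V
  proof -
    obtain g w w' where u_eq: "U = L2_class (spacetime T M) g" and u_rep: "curve_rep T M L g w w'"
      using U unfolding curve_image_def by blast
    note u = u_eq curve_repD[OF u_rep]
    obtain h y y' where v_eq: "V = L2_class (spacetime T M) h" and v_rep: "curve_rep T M L h y y'"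
      using V unfolding curve_image_def by blast
    note v = v_eq curve_repD[OF v_rep]
    have A: "embedded_op M L (w t + y t) = embedded_op M L (w t) + embedded_op M L (y t)" if "t \<in> {0..T}"
      for t
      using embedded_op_add[OF L u(6)[OF that] v(6)[OF that]] .
    \<comment> \<open>\<open>L\<close> may be unbounded, so continuity along the sum is inferred
      from that along the two summands by additivity.\<close>
    have cont: "continuous_on {0..T} (\<lambda>t. embedded_op M L (w t + y t))"
      using continuous_on_add[OF u(5) v(5)] by (rule continuous_on_eq) (simp add: A)
    have "L2_add (spacetime T M) U V = L2_class (spacetime T M) (\<lambda>z. g z + h z)"
      using u(1,2) v(1,2) by (simp add: L2_add_class)
    also have "\<dots> \<in> curve_image T M L"
    proof (rule curve_imageI[where w = "\<lambda>t. w t + y t" and w' = "\<lambda>t. w' t + y' t"])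
      show "(\<lambda>z. g z + h z) \<in> sq_integrable (spacetime T M)" using u(2) v(2) by (rule sq_integrable_add)
      show "w T + y T = 0" by (simp add: u v)
      show "continuous_on {0..T} (\<lambda>t. w' t + y' t)" using u(4) v(4) by (rule continuous_on_add)
      show "continuous_on {0..T} (\<lambda>t. embedded_op M L (w t + y t))" by (rule cont)
      fix t assume t: "t \<in> {0..T}"
      show "w t + y t \<in> l2_embed M ` dom L" using subspace_add[OF sub u(6)[OF t] v(6)[OF t]] .
      show "((\<lambda>t. w t + y t) has_vector_derivative w' t + y' t) (at t within {0..T})"
        using has_vector_derivative_add[OF u(7)[OF t] v(7)[OF t]] .
      show "(\<lambda>x. g (t, x) + h (t, x)) \<in> sq_integrable M" using u(8)[OF t] v(8)[OF t]
        by (rule sq_integrable_add)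
      show "l2_embed M (L2_class M (\<lambda>x. g (t, x) + h (t, x))) = w' t + y' t + embedded_op M L (w t + y t)"
        using embed_class_add[OF u(8)[OF t] v(8)[OF t]] u(9)[OF t] v(9)[OF t] A[OF t] by simp
    qed
    finally show ?thesis .
  qed
  moreover have "L2_scale (spacetime T M) c U \<in> curve_image T M L"
    if U: "U \<in> curve_image T M L" for U c
  proof -
    obtain g w w' where u_eq: "U = L2_class (spacetime T M) g" and u_rep: "curve_rep T M L g w w'"
      using U unfolding curve_image_def by blast
    note u = u_eq curve_repD[OF u_rep]
    have A: "embedded_op M L (c *\<^sub>R w t) = c *\<^sub>R embedded_op M L (w t)" if "t \<in> {0..T}" for t
      using embedded_op_scale[OF L u(6)[OF that]] .
    have cont: "continuous_on {0..T} (\<lambda>t. embedded_op M L (c *\<^sub>R w t))"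
      using continuous_on_scaleR[OF continuous_on_const[of _ c] u(5)]
        by (rule continuous_on_eq) (simp add: A)
    have "L2_scale (spacetime T M) c U = L2_class (spacetime T M) (\<lambda>z. c * g z)"
      using u(1,2) by (simp add: L2_scale_class)
    also have "\<dots> \<in> curve_image T M L"
    proof (rule curve_imageI[where w = "\<lambda>t. c *\<^sub>R w t" and w' = "\<lambda>t. c *\<^sub>R w' t"])
      show "(\<lambda>z. c * g z) \<in> sq_integrable (spacetime T M)" using u(2) by (rule sq_integrable_scale)
      show "c *\<^sub>R w T = 0" by (simp add: u)
      show "continuous_on {0..T} (\<lambda>t. c *\<^sub>R w' t)" by (intro continuous_intros u(4))
      show "continuous_on {0..T} (\<lambda>t. embedded_op M L (c *\<^sub>R w t))" by (rule cont)
      fix t assume t: "t \<in> {0..T}"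
      show "c *\<^sub>R w t \<in> l2_embed M ` dom L" using subspace_scale[OF sub u(6)[OF t]] .
      show "((\<lambda>t. c *\<^sub>R w t) has_vector_derivative c *\<^sub>R w' t) (at t within {0..T})"
        using bounded_linear.has_vector_derivative[OF bounded_linear_scaleR_right u(7)[OF t]] .
      show "(\<lambda>x. c * g (t, x)) \<in> sq_integrable M" using u(8)[OF t] by (rule sq_integrable_scale)
      show "l2_embed M (L2_class M (\<lambda>x. c * g (t, x))) = c *\<^sub>R w' t + embedded_op M L (c *\<^sub>R w t)"
        using embed_class_scale[OF u(8)[OF t]] u(9)[OF t] A[OF t] by (simp add: scaleR_add_right)
    qed
    finally show ?thesis .
  qed
  ultimately show ?thesis unfolding L2_subspace_def by blast
qed

text \<open>A tensor comes from a curve on the line through \<open>\<phi>\<close>. Fixing the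
  representatives \<open>p\<close> and \<open>q\<close> identifies its sections for every
  \<open>t\<close>, not merely for almost every \<open>t\<close>, as \<open>curve_rep\<close>
  demands.\<close>

lemma spacetime_image_subset:
  assumes M: "sigma_finite_measure M" and L: "L2_linear_operator M L"
  shows "spacetime_image T M L \<subseteq> curve_image T M L"
proof
  fix U assume "U \<in> spacetime_image T M L"
  then obtain f f' \<phi> where U: "U = L2_add (spacetime T M) (L2_tensor T M f' \<phi>)
    (L2_tensor T M f (the (L \<phi>)))"
    and \<phi>: "\<phi> \<in> dom L" and C1: "C1_with_deriv T f f'" and fT: "f T = 0"
    unfolding spacetime_image_def by blast
  note D = L2_linear_operatorD[OF L]
  have df: "(f has_vector_derivative f' t) (at t within {0..T})" if "t \<in> {0..T}" for t
    using C1 that by (simp add: C1_with_deriv_def has_real_derivative_iff_has_vector_derivative)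
  have f': "continuous_on {0..T} f'" using C1 by (simp add: C1_with_deriv_def)
  have f: "continuous_on {0..T} f" using df by (rule continuous_on_vector_derivative)
  define p where "p = L2_rep \<phi>"
  define q where "q = L2_rep (the (L \<phi>))"
  have p: "p \<in> sq_integrable M" "L2_class M p = \<phi>" using L2_rep[OF D(2)[OF \<phi>]] by (auto simp: p_def)
  have q: "q \<in> sq_integrable M" "L2_class M q = the (L \<phi>)" using L2_rep[OF D(3)[OF \<phi>]]
    by (auto simp: q_def)
  note tensors = sq_integrable_tensor[OF M f' p(1)] sq_integrable_tensor[OF M f q(1)]
  define x where "x = l2_embed M \<phi>"
  have x: "x \<in> l2_embed M ` dom L" "embedded_op M L x = l2_embed M (the (L \<phi>))"
    using \<phi> embedded_op_embed[OF L] by (auto simp: x_def)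
  have A: "embedded_op M L (c *\<^sub>R x) = c *\<^sub>R l2_embed M (the (L \<phi>))" for c
    using embedded_op_scale[OF L x(1)] x(2) by simp
  have "U = L2_class (spacetime T M) (\<lambda>z. (case z of (t, x) \<Rightarrow> f' t * p x)
    + (case z of (t, x) \<Rightarrow> f t * q x))"
    unfolding U L2_tensor_def p_def[symmetric] q_def[symmetric] using tensors by (rule L2_add_class)
  also have "\<dots> \<in> curve_image T M L"
  proof (rule curve_imageI[where w = "\<lambda>t. f t *\<^sub>R x" and w' = "\<lambda>t. f' t *\<^sub>R x"])
    show "(\<lambda>z. (case z of (t, x) \<Rightarrow> f' t * p x) + (case z of (t, x) \<Rightarrow> f t * q x)) \<in> sq_integrable
      (spacetime T M)"
      using tensors by (rule sq_integrable_add)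
    show "f T *\<^sub>R x = 0" by (simp add: fT)
    show "continuous_on {0..T} (\<lambda>t. f' t *\<^sub>R x)" by (intro continuous_intros f')
    show "continuous_on {0..T} (\<lambda>t. embedded_op M L (f t *\<^sub>R x))" unfolding A
      by (intro continuous_intros f)
    fix t assume t: "t \<in> {0..T}"
    show "f t *\<^sub>R x \<in> l2_embed M ` dom L" using subspace_scale[OF subspace_embed[OF D(1)] x(1)] .
    show "((\<lambda>t. f t *\<^sub>R x) has_vector_derivative f' t *\<^sub>R x) (at t within {0..T})"
      using bounded_linear.has_vector_derivative[OF bounded_linear_scaleR_left df[OF t]] .
    show "(\<lambda>y. (case (t, y) of (t, x) \<Rightarrow> f' t * p x) + (case (t, y) of (t, x) \<Rightarrow> f t * q x)) \<in> sq_integrable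
      M"
      using p q by auto
    show "l2_embed M (L2_class M (\<lambda>y. (case (t, y) of (t, x) \<Rightarrow> f' t * p x)
      + (case (t, y) of (t, x) \<Rightarrow> f t * q x)))
        = f' t *\<^sub>R x + embedded_op M L (f t *\<^sub>R x)"
      using p q by (simp add: A embed_class_add embed_class_scale sq_integrable_scale flip: x_def)
  qed
  finally show "U \<in> curve_image T M L" .
qed

lemma span_subset_curve_image:
  assumes "sigma_finite_measure M" "L2_linear_operator M L"
  shows "L2_span (spacetime T M) (spacetime_image T M L) \<subseteq> curve_image T M L"
  unfolding L2_span_def
  by (intro hull_minimal spacetime_image_subset L2_subspace_curve_image assms)

lemma approximable_of_dense:
  assumes M: "sigma_finite_measure M" and L: "L2_linear_operator M L"
    and dense: "L2_dense (spacetime T M) (L2_span (spacetime T M) (spacetime_image T M L))"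
    and u: "u \<in> l2_embed M ` dom L" and "e > 0"
  shows "\<exists>z r. z 0 = u
      \<and> (\<forall>t\<in>{0..T}. z t \<in> l2_embed M ` dom L \<and> (z has_vector_derivative embedded_op M L (z t) + r t)
        (at t within {0..T}))
      \<and> continuous_on {0..T} r \<and> integral {0..T} (\<lambda>t. (norm (r t))\<^sup>2) < e"
proof -
  note D = L2_linear_operatorD[OF L]
  let ?S = "spacetime T M" and ?A = "embedded_op M L"
  have sub: "subspace (l2_embed M ` dom L)" by (rule subspace_embed[OF D(1)])
  obtain \<phi> where \<phi>: "\<phi> \<in> dom L" "u = l2_embed M \<phi>" using u by blast
  define q where "q = L2_rep (the (L \<phi>))"
  have q: "q \<in> sq_integrable M" "L2_class M q = the (L \<phi>)" using L2_rep[OF D(3)[OF \<phi>(1)]]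
    by (auto simp: q_def)
  have Au: "?A u = l2_embed M (L2_class M q)" using embedded_op_embed[OF L \<phi>(1)] \<phi>(2) q(2) by simp
  \<comment> \<open>The target \<open>- L u\<close>, written as a tensor with constant time factor
    \<open>- 1\<close> so that \<open>sq_integrable_tensor\<close> applies.\<close>
  define h :: "real \<times> _ \<Rightarrow> real" where "h = (\<lambda>(t, x). (- 1) * q x)"
  have h: "h \<in> sq_integrable ?S"
    unfolding h_def by (rule sq_integrable_tensor[OF M _ q(1)]) auto
  obtain U where U: "U \<in> curve_image T M L" "L2_dist ?S (L2_class ?S h) U < sqrt e"
    using dense L2_class_in[OF h] \<open>e > 0\<close> span_subset_curve_image[OF M L]
    unfolding L2_dense_def by (meson real_sqrt_gt_zero subsetD)
  obtain g w w' where g_eq: "U = L2_class (spacetime T M) g" and g_rep: "curve_rep T M L g w w'"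
    using U(1) unfolding curve_image_def by blast
  note g = g_eq curve_repD[OF g_rep]
  \<comment> \<open>\<open>s t\<close> is the embedded section of \<open>h - g\<close> at time
    \<open>t\<close>, so its integrated squared norm is the squared space-time distance.\<close>
  define s where "s t = - ?A u - (w' t + ?A (w t))" for t
  have "(L2_dist ?S (L2_class ?S h) U)\<^sup>2 = (\<integral>z. (h z - g z)\<^sup>2 \<partial>?S)"
    using dist_embed_class[OF h g(2)] dist_embed[OF L2_class_in[OF h] L2_class_in[OF g(2)]] g(1) by simp
  also have "\<dots> = integral {0..T} (\<lambda>t. \<integral>x. (h (t, x) - g (t, x))\<^sup>2 \<partial>M)"
    by (rule spacetime_integral[OF M sq_integrable_diff[OF h g(2)]])
  also have "\<dots> = integral {0..T} (\<lambda>t. (norm (s t))\<^sup>2)"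
  proof (rule Henstock_Kurzweil_Integration.integral_cong)
    fix t assume t: "t \<in> {0..T}"
    have "l2_embed M (L2_class M (\<lambda>x. (- 1) * q x)) = - ?A u"
      unfolding embed_class_scale[OF q(1)] Au by simp
    then have "(norm (s t))\<^sup>2 = (\<integral>x. ((- 1) * q x - g (t, x))\<^sup>2 \<partial>M)"
      unfolding s_def g(9)[OF t, symmetric]
      using dist_embed_class[OF sq_integrable_scale[OF q(1)] g(8)[OF t], of "- 1"] by simp
    then show "(\<integral>x. (h (t, x) - g (t, x))\<^sup>2 \<partial>M) = (norm (s t))\<^sup>2" by (simp add: h_def)
  qed
  finally have eq: "integral {0..T} (\<lambda>t. (norm (s t))\<^sup>2) = (L2_dist ?S (L2_class ?S h) U)\<^sup>2" by simp
  have "(L2_dist ?S (L2_class ?S h) U)\<^sup>2 < (sqrt e)\<^sup>2"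
    using U(2) by (intro power_strict_mono) (auto simp: L2_dist_def L2_norm_def L2_inner_ge_zero)
  then have small: "integral {0..T} (\<lambda>t. (norm (s (T - t)))\<^sup>2) < e"
    using eq \<open>e > 0\<close> by (simp add: integral_flip[of T "\<lambda>t. (norm (s t))\<^sup>2"])
  \<comment> \<open>\<open>w T = 0\<close> gives \<open>z 0 = u\<close>. Reversal changes the sign
    of \<open>w'\<close>, so the residual of \<open>z\<close> at \<open>t\<close> is
    \<open>- w' (T - t) - ?A u - ?A (w (T - t))\<close>, which is \<open>s (T - t)\<close>.\<close>
  define z where "z t = u + w (T - t)" for t
  have s_cont: "continuous_on {0..T} s" unfolding s_def by (intro continuous_intros g(4,5))
  show ?thesis
  proof (rule exI[of _ z], rule exI[of _ "\<lambda>t. s (T - t)"], intro conjI ballI)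
    show "z 0 = u" by (simp add: z_def g(3))
    show "continuous_on {0..T} (\<lambda>t. s (T - t))"
      by (intro continuous_on_compose2[OF s_cont] continuous_intros) auto
    show "integral {0..T} (\<lambda>t. (norm (s (T - t)))\<^sup>2) < e" by (rule small)
    fix t assume t: "t \<in> {0..T}"
    then have t': "T - t \<in> {0..T}" by auto
    show "z t \<in> l2_embed M ` dom L" unfolding z_def using subspace_add[OF sub u g(6)[OF t']] .
    have Az: "?A (z t) = ?A u + ?A (w (T - t))"
      unfolding z_def using embedded_op_add[OF L u g(6)[OF t']] .
    have "(z has_vector_derivative 0 + - w' (T - t)) (at t within {0..T})"
      unfolding z_def[abs_def]
      by (intro has_vector_derivative_add has_vector_derivative_const has_vector_derivative_flip g(7) t)
    then show "(z has_vector_derivative ?A (z t) + s (T - t)) (at t within {0..T})"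
      by (simp add: Az s_def)
  qed
qed

section \<open>Symmetric generators\<close>

lemma closure_embed_dense:
  assumes "L2_dense M V" shows "l2_embed M ` L2 M \<subseteq> closure (l2_embed M ` V)"
proof
  fix x assume "x \<in> l2_embed M ` L2 M"
  then obtain u where u: "u \<in> L2 M" "x = l2_embed M u" by auto
  have "\<exists>y\<in>l2_embed M ` V. dist y x < e" if e: "e > 0" for e
  proof -
    obtain v where "v \<in> V" "L2_dist M u v < e" using assms u e unfolding L2_dense_def by blast
    then show ?thesis
      using assms u by (auto simp: L2_dense_def dist_norm norm_minus_commute dist_embed intro!:
        bexI[of _ v])
  qed
  then show "x \<in> closure (l2_embed M ` V)" by (simp add: closure_approachable)
qed

lemma L2_symmetricD:
  assumes "L2_symmetric M L" "u \<in> dom L" "v \<in> dom L"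
  shows "L2_inner M (the (L u)) v = L2_inner M u (the (L v))"
proof -
  have "(v, the (L v)) \<in> L2_adjoint_graph M L"
    using assms by (auto simp: L2_symmetric_def Map.graph_def)
  then show ?thesis using assms by (auto simp: L2_adjoint_graph_def)
qed

section \<open>Orbits of a strongly continuous semigroup\<close>

lemma L2_C0_semigroupD:
  assumes "L2_C0_semigroup M S" "0 \<le> t"
  shows "u \<in> L2 M \<Longrightarrow> S t u \<in> L2 M"
    and "u \<in> L2 M \<Longrightarrow> v \<in> L2 M \<Longrightarrow> S t (L2_add M u v) = L2_add M (S t u) (S t v)"
    and "u \<in> L2 M \<Longrightarrow> S t (L2_scale M c u) = L2_scale M c (S t u)"
    and "u \<in> L2 M \<Longrightarrow> S 0 u = u"
    and "0 \<le> s \<Longrightarrow> u \<in> L2 M \<Longrightarrow> S (s + t) u = S s (S t u)"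
    and "u \<in> L2 M \<Longrightarrow> ((\<lambda>s. L2_dist M (S s u) (S t u)) \<longlongrightarrow> 0) (at t within {0..})"
    and "L2_continuous_linear M (S t)"
  using assms by (auto simp: L2_C0_semigroup_def L2_continuous_linear_def)

lemma L2_continuous_linear_tendsto:
  assumes A: "L2_continuous_linear M A" and u: "u \<in> L2 M" and v: "eventually (\<lambda>x. v x \<in> L2 M) F"
    and lim: "((\<lambda>x. l2_embed M (v x)) \<longlongrightarrow> l2_embed M u) F"
  shows "((\<lambda>x. l2_embed M (A (v x))) \<longlongrightarrow> l2_embed M (A u)) F"
proof (rule tendstoI)
  fix e :: real assume "e > 0"
  then obtain d where d: "d > 0" "\<And>w. w \<in> L2 M \<Longrightarrow> L2_dist M w u < d \<Longrightarrow> L2_dist M (A w) (A u) < e"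
    using A u unfolding L2_continuous_linear_def by meson
  have in_L2: "w \<in> L2 M \<Longrightarrow> A w \<in> L2 M" for w using A by (simp add: L2_continuous_linear_def)
  show "eventually (\<lambda>x. dist (l2_embed M (A (v x))) (l2_embed M (A u)) < e) F"
    using tendstoD[OF lim \<open>d > 0\<close>] v
    by eventually_elim (use d u in_L2 in \<open>simp add: dist_norm dist_embed\<close>)
qed

lemma L2_C0_semigroup_continuous:
  assumes S: "L2_C0_semigroup M S" and u: "u \<in> L2 M"
  shows "continuous_on {0..T} (\<lambda>t. l2_embed M (S t u))"
proof -
  have "((\<lambda>s. l2_embed M (S s u)) \<longlongrightarrow> l2_embed M (S t u)) (at t within {0..T})" if t: "t \<in> {0..T}" for t
  proof -
    have "((\<lambda>s. L2_dist M (S s u) (S t u)) \<longlongrightarrow> 0) (at t within {0..T})"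
      using L2_C0_semigroupD(6)[OF S _ u, of t] t by (auto intro: tendsto_within_subset)
    moreover have "eventually (\<lambda>s. L2_dist M (S s u) (S t u)
      = norm (l2_embed M (S s u) - l2_embed M (S t u)))
        (at t within {0..T})"
      unfolding eventually_at_filter using t u
      by (intro always_eventually allI impI) (simp add: dist_embed L2_C0_semigroupD(1)[OF S])
    ultimately have "((\<lambda>s. norm (l2_embed M (S s u) - l2_embed M (S t u))) \<longlongrightarrow> 0) (at t within {0..T})"
      by (rule Lim_transform_eventually)
    then show ?thesis by (simp add: tendsto_norm_zero_iff LIM_zero_iff)
  qed
  then show ?thesis by (simp add: continuous_on_def)
qed

lemma generator_limit_iff:
  assumes S: "\<And>t. 0 < t \<Longrightarrow> S t u \<in> L2 M" and u: "u \<in> L2 M" and v: "v \<in> L2 M"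
  shows "((\<lambda>t. L2_dist M (L2_scale M (1 / t) (L2_diff M (S t u) u)) v) \<longlongrightarrow> 0) (at_right 0)
    \<longleftrightarrow> ((\<lambda>t. (1 / t) *\<^sub>R (l2_embed M (S t u) - l2_embed M u)) \<longlongrightarrow> l2_embed M v) (at_right 0)"
proof -
  have eq: "L2_dist M (L2_scale M (1 / t) (L2_diff M (S t u) u)) v
      = norm ((1 / t) *\<^sub>R (l2_embed M (S t u) - l2_embed M u) - l2_embed M v)" if "0 < t" for t
    using S[OF that] u v by (simp add: L2_scale_in L2_diff_in embed_scale embed_diff flip: dist_embed)
  have "((\<lambda>t. L2_dist M (L2_scale M (1 / t) (L2_diff M (S t u) u)) v) \<longlongrightarrow> 0) (at_right 0)
    \<longleftrightarrow> ((\<lambda>t. norm ((1 / t) *\<^sub>R (l2_embed M (S t u) - l2_embed M u) - l2_embed M v)) \<longlongrightarrow> 0) (at_right 0)"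
    by (intro filterlim_cong refl) (use eq in \<open>auto simp: eventually_at_filter\<close>)
  then show ?thesis by (simp add: tendsto_norm_zero_iff LIM_zero_iff)
qed

lemma L2_generator_of_iff:
  assumes "L2_C0_semigroup M S" "L2_generator_of M S L" "u \<in> L2 M" "v \<in> L2 M"
  shows "L u = Some v \<longleftrightarrow> ((\<lambda>t. (1 / t) *\<^sub>R (l2_embed M (S t u) - l2_embed M u))
    \<longlongrightarrow> l2_embed M v) (at_right 0)"
  using assms(2-4) generator_limit_iff[of S u M v] L2_C0_semigroupD(1)[OF assms(1) less_imp_le]
  by (simp add: L2_generator_of_def)

text \<open>Apply the continuous operator \<open>S s\<close> to the difference quotient of
  \<open>u\<close> at time 0. By the semigroup law the result is also the quotient of the orbit at
  \<open>s\<close>, which gives the right derivative, and the quotient of \<open>S s u\<close> at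
  time 0, which gives invariance of the domain.\<close>

lemma generator_orbit:
  assumes S: "L2_C0_semigroup M S" and L: "L2_generator_of M S L" and u: "L u = Some v" and s: "0 \<le> s"
  shows "((\<lambda>s. l2_embed M (S s u)) has_vector_derivative l2_embed M (S s v)) (at_right s)"
    and "L (S s u) = Some (S s v)"
proof -
  note D = L2_C0_semigroupD[OF S]
  have uv: "u \<in> L2 M" "v \<in> L2 M" using u L by (auto simp: L2_generator_of_def)
  define w where "w h = L2_scale M (1 / h) (L2_diff M (S h u) u)" for h
  have w_in: "w h \<in> L2 M" if "0 < h" for h
    using that uv D(1)[of h] by (simp add: w_def L2_scale_in L2_diff_in)
  have w_embed: "l2_embed M (w h) = (1 / h) *\<^sub>R (l2_embed M (S h u) - l2_embed M u)" if "0 < h" for h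
    using that uv D(1)[of h] by (simp add: w_def embed_scale embed_diff L2_diff_in)
  have "((\<lambda>h. (1 / h) *\<^sub>R (l2_embed M (S h u) - l2_embed M u)) \<longlongrightarrow> l2_embed M v) (at_right 0)"
    using u L2_generator_of_iff[OF S L uv] by simp
  then have "((\<lambda>h. l2_embed M (w h)) \<longlongrightarrow> l2_embed M v) (at_right 0)"
    by (rule Lim_transform_eventually) (use w_embed in \<open>auto simp: eventually_at_filter\<close>)
  then have lim_w: "((\<lambda>h. l2_embed M (S s (w h))) \<longlongrightarrow> l2_embed M (S s v)) (at_right 0)"
    using w_in by (intro L2_continuous_linear_tendsto[OF D(7)[OF s] uv(2)])
      (auto simp: eventually_at_filter)
  have Sw: "l2_embed M (S s (w h)) = (1 / h) *\<^sub>R (l2_embed M (S s (S h u)) - l2_embed M (S s u))"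
    if "0 < h" for h
    using that s uv D(1)[of h] D(1)[of s]
    by (simp add: w_def L2_diff_eq D(2,3)[OF s] embed_scale embed_add L2_add_in L2_scale_in)
  have lim: "((\<lambda>h. (1 / h) *\<^sub>R (l2_embed M (S s (S h u)) - l2_embed M (S s u)))
    \<longlongrightarrow> l2_embed M (S s v)) (at_right 0)"
    using lim_w by (rule Lim_transform_eventually) (use Sw in \<open>auto simp: eventually_at_filter\<close>)
  have "((\<lambda>h. (1 / h) *\<^sub>R (l2_embed M (S (s + h) u) - l2_embed M (S s u)))
    \<longlongrightarrow> l2_embed M (S s v)) (at_right 0)"
    using lim by (rule Lim_transform_eventually) (use D(5) s uv in \<open>auto simp: eventually_at_filter\<close>)
  then show "((\<lambda>s. l2_embed M (S s u)) has_vector_derivative l2_embed M (S s v)) (at_right s)"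
    by (rule has_vector_derivative_at_rightI)
  have comm: "S s (S h u) = S h (S s u)" if "0 < h" for h
    using that s uv D(5)[of h s u] D(5)[of s h u] by (simp add: add.commute)
  have "((\<lambda>h. (1 / h) *\<^sub>R (l2_embed M (S h (S s u)) - l2_embed M (S s u)))
    \<longlongrightarrow> l2_embed M (S s v)) (at_right 0)"
    using lim by (rule Lim_transform_eventually) (use comm in \<open>auto simp: eventually_at_filter\<close>)
  then show "L (S s u) = Some (S s v)"
    using L2_generator_of_iff[OF S L, of "S s u" "S s v"] uv D(1)[OF s] by simp
qed

section \<open>Uniqueness and existence of the symmetric generator\<close>

context
  fixes M :: "'a measure" and L0 :: "'a l2_op"
  assumes M: "sigma_finite_measure M" and dense_dom: "L2_dense M (dom L0)"
    and L0: "L2_linear_operator M L0" and sym: "L2_symmetric M L0"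
    and bounded: "L2_upper_bounded M L0"
    and dense: "\<And>T. 0 < T \<Longrightarrow> L2_dense (spacetime T M) (L2_span (spacetime T M) (spacetime_image T M L0))"
begin

lemma approximable_evolution_embedded:
  "\<exists>c. approximable_evolution (l2_embed M ` L2 M) (l2_embed M ` dom L0) (embedded_op M L0) c"
proof -
  note D = L2_linear_operatorD[OF L0]
  obtain b where b: "\<And>u. u \<in> dom L0 \<Longrightarrow> u \<noteq> L2_zero M \<Longrightarrow> L2_inner M (the (L0 u)) u / (L2_norm M u)\<^sup>2 \<le> b"
    using bounded by (force simp: L2_upper_bounded_def bdd_above_def)
  \<comment> \<open>The upper bound \<open>b\<close> may be negative, whereas the locale wants a
    nonnegative constant to make \<open>growth\<close> increasing.\<close>
  have "approximable_evolution (l2_embed M ` L2 M) (l2_embed M ` dom L0) (embedded_op M L0) (max b 0)"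
  proof
    show "subspace (l2_embed M ` L2 M)" by (rule subspace_embed[OF L2_subspace_L2])
    show "complete (l2_embed M ` L2 M)" by (rule complete_embed)
    show "subspace (l2_embed M ` dom L0)" by (rule subspace_embed[OF D(1)])
    show "l2_embed M ` dom L0 \<subseteq> l2_embed M ` L2 M" using D(2) by auto
    show "l2_embed M ` L2 M \<subseteq> closure (l2_embed M ` dom L0)" by (rule closure_embed_dense[OF dense_dom])
    show "embedded_op M L0 x \<in> l2_embed M ` L2 M" if "x \<in> l2_embed M ` dom L0" for x
      using embedded_op_in[OF L0 that] .
    show "embedded_op M L0 (x + y) = embedded_op M L0 x + embedded_op M L0 y"
      if "x \<in> l2_embed M ` dom L0" "y \<in> l2_embed M ` dom L0" for x y
      using embedded_op_add[OF L0 that] .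
    show "embedded_op M L0 (a *\<^sub>R x) = a *\<^sub>R embedded_op M L0 x" if "x \<in> l2_embed M ` dom L0" for a x
      using embedded_op_scale[OF L0 that] .
    show "inner (embedded_op M L0 x) y = inner x (embedded_op M L0 y)"
      if xy: "x \<in> l2_embed M ` dom L0" "y \<in> l2_embed M ` dom L0" for x y
    proof -
      obtain u v where "u \<in> dom L0" "x = l2_embed M u" "v \<in> dom L0" "y = l2_embed M v" using xy by blast
      then show ?thesis using L2_symmetricD[OF sym, of u v] D(2,3)
        by (simp add: embedded_op_embed[OF L0] inner_embed)
    qed
    show "inner (embedded_op M L0 x) x \<le> max b 0 * (norm x)\<^sup>2" if x: "x \<in> l2_embed M ` dom L0" for x
    proof -
      obtain u where u: "u \<in> dom L0" "x = l2_embed M u" using x by blast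
      note uL = D(2)[OF u(1)] D(3)[OF u(1)]
      show ?thesis
      \<comment> \<open>The supremum excludes the zero vector, for which both sides vanish.\<close>
      proof (cases "u = L2_zero M")
        case True
        then show ?thesis using u by (simp add: embed_zero)
      next
        case False
        then have "x \<noteq> 0" using u uL by (metis embed_inject embed_zero L2_zero_in)
        then have pos: "(norm x)\<^sup>2 > 0" by simp
        have "inner (embedded_op M L0 x) x / (norm x)\<^sup>2 \<le> b"
          using b[OF u(1) False] u uL by (simp add: embedded_op_embed[OF L0] inner_embed norm_embed)
        then have "inner (embedded_op M L0 x) x \<le> b * (norm x)\<^sup>2" using pos
          by (simp add: pos_divide_le_eq)
        also have "\<dots> \<le> max b 0 * (norm x)\<^sup>2" by (intro mult_right_mono) auto
        finally show ?thesis .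
      qed
    qed
    show "0 \<le> max b 0" by simp
    show "\<exists>z r. z 0 = u
        \<and> (\<forall>t\<in>{0..T}. z t \<in> l2_embed M ` dom L0
            \<and> (z has_vector_derivative embedded_op M L0 (z t) + r t) (at t within {0..T}))
        \<and> continuous_on {0..T} r \<and> integral {0..T} (\<lambda>t. (norm (r t))\<^sup>2) < e"
      if "0 < T" "u \<in> l2_embed M ` dom L0" "0 < e" for T u and e :: real
      using approximable_of_dense[OF M L0 dense[OF that(1)] that(2,3)] .
  qed
  then show ?thesis by blast
qed

text \<open>A generator is determined by its semigroup, and the two semigroups need only be compared
  on \<open>dom L0\<close>: density and the continuity of each operator do the rest.\<close>

lemma M_sym_unique:
  assumes mem: "K1 \<in> M_sym M L0" "K2 \<in> M_sym M L0" shows "K1 = K2"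
proof -
  obtain c where "approximable_evolution (l2_embed M ` L2 M) (l2_embed M ` dom L0) (embedded_op M L0) c"
    using approximable_evolution_embedded by blast
  then interpret approximable_evolution "l2_embed M ` L2 M" "l2_embed M ` dom L0" "embedded_op M L0" c .
  note D0 = L2_linear_operatorD[OF L0]
  \<comment> \<open>Orbits starting in \<open>dom L0\<close> are weak solutions:
    \<open>S s u\<close> stays in \<open>dom L\<close>, where symmetry of \<open>L\<close> can be
    used against \<open>y\<close>, on which \<open>L\<close> agrees with \<open>L0\<close>.\<close>
  have weak: "inner (l2_embed M (S s (the (L0 u)))) y = inner (l2_embed M (S s u)) (embedded_op M L0 y)"
    if L: "L \<in> M_sym M L0" and S: "L2_C0_semigroup M S" "L2_generator_of M S L"
      and u: "u \<in> dom L0" and s: "0 \<le> s" and y: "y \<in> l2_embed M ` dom L0" for L S u s y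
  proof -
    have ext: "L w = Some (the (L0 w))" if "w \<in> dom L0" for w
      using L that by (auto simp: M_sym_def Map.graph_def)
    obtain v where v: "v \<in> dom L0" "y = l2_embed M v" using y by blast
    have Su: "L (S s u) = Some (S s (the (L0 u)))" using generator_orbit(2)[OF S ext[OF u] s] .
    have "L2_inner M (the (L (S s u))) v = L2_inner M (S s u) (the (L v))"
      using L Su ext[OF v(1)] by (intro L2_symmetricD) (auto simp: M_sym_def)
    then show ?thesis
      using Su ext[OF v(1)] v D0(2,3) u s L2_C0_semigroupD(1)[OF S(1) s]
      by (simp add: inner_embed embedded_op_embed[OF L0])
  qed
  obtain S1 where S1: "L2_C0_semigroup M S1" "L2_generator_of M S1 K1" using mem
    by (auto simp: M_sym_def L2_generator_def)
  obtain S2 where S2: "L2_C0_semigroup M S2" "L2_generator_of M S2 K2" using mem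
    by (auto simp: M_sym_def L2_generator_def)
  have ext1: "K1 u = Some (the (L0 u))" and ext2: "K2 u = Some (the (L0 u))" if "u \<in> dom L0" for u
    using mem that by (auto simp: M_sym_def Map.graph_def)
  have on_dom: "S1 t u = S2 t u" if "0 \<le> t" "u \<in> dom L0" for t u
  proof -
    have u: "u \<in> L2 M" using D0(2) that by blast
    have "l2_embed M (S1 t u) = l2_embed M (S2 t u)"
    proof (rule weak_solution_unique[OF \<open>0 \<le> t\<close>, where z = "\<lambda>s. l2_embed M (S1 s u)" and y =
      "\<lambda>s. l2_embed M (S2 s u)"])
      show "continuous_on {0..t} (\<lambda>s. l2_embed M (S1 s u))"
        by (rule L2_C0_semigroup_continuous[OF S1(1) u])
      show "continuous_on {0..t} (\<lambda>s. l2_embed M (S2 s u))"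
        by (rule L2_C0_semigroup_continuous[OF S2(1) u])
      show "((\<lambda>s. l2_embed M (S1 s u)) has_vector_derivative l2_embed M (S1 s (the (L0 u)))) (at_right s)"
        if "0 \<le> s" for s using generator_orbit(1)[OF S1 ext1 that] \<open>u \<in> dom L0\<close> .
      show "((\<lambda>s. l2_embed M (S2 s u)) has_vector_derivative l2_embed M (S2 s (the (L0 u)))) (at_right s)"
        if "0 \<le> s" for s using generator_orbit(1)[OF S2 ext2 that] \<open>u \<in> dom L0\<close> .
      show "inner (l2_embed M (S1 s (the (L0 u)))) y = inner (l2_embed M (S1 s u)) (embedded_op M L0 y)"
        if "0 \<le> s" "y \<in> l2_embed M ` dom L0" for s y using weak[OF mem(1) S1] that \<open>u \<in> dom L0\<close> by blast
      show "inner (l2_embed M (S2 s (the (L0 u)))) y = inner (l2_embed M (S2 s u)) (embedded_op M L0 y)"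
        if "0 \<le> s" "y \<in> l2_embed M ` dom L0" for s y using weak[OF mem(2) S2] that \<open>u \<in> dom L0\<close> by blast
      show "l2_embed M (S1 0 u) = l2_embed M (S2 0 u)"
        using u L2_C0_semigroupD(4)[OF S1(1), of 0] L2_C0_semigroupD(4)[OF S2(1), of 0] by simp
    qed (use u that L2_C0_semigroupD(1)[OF S1(1)] L2_C0_semigroupD(1)[OF S2(1)] in auto)
    then show ?thesis
      using embed_inject[OF L2_C0_semigroupD(1)[OF S1(1) \<open>0 \<le> t\<close> u]
        L2_C0_semigroupD(1)[OF S2(1) \<open>0 \<le> t\<close> u]]
      by simp
  qed
  have eq: "S1 t u = S2 t u" if t: "0 \<le> t" and u: "u \<in> L2 M" for t u
  proof -
    have "l2_embed M u \<in> closure (l2_embed M ` dom L0)" using closure_embed_dense[OF dense_dom] u by blast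
    then obtain x where x: "\<And>n. x n \<in> l2_embed M ` dom L0" "x \<longlonglongrightarrow> l2_embed M u"
      unfolding closure_sequential by blast
    define v where "v n = component (x n) M" for n
    have v: "v n \<in> dom L0" "l2_embed M (v n) = x n" for n
    proof -
      obtain w where "w \<in> dom L0" "x n = l2_embed M w" using x(1)[of n] by blast
      then show "v n \<in> dom L0" "l2_embed M (v n) = x n" using D0(2)[of w] by (simp_all add: v_def)
    qed
    have lim: "(\<lambda>n. l2_embed M (v n)) \<longlonglongrightarrow> l2_embed M u" using x(2) v(2) by simp
    have ev: "eventually (\<lambda>n. v n \<in> L2 M) sequentially" using v(1) D0(2) by simp
    have "(\<lambda>n. l2_embed M (S1 t (v n))) \<longlonglongrightarrow> l2_embed M (S1 t u)"
      by (rule L2_continuous_linear_tendsto[OF L2_C0_semigroupD(7)[OF S1(1) t] u ev lim])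
    moreover have "(\<lambda>n. l2_embed M (S1 t (v n))) \<longlonglongrightarrow> l2_embed M (S2 t u)"
      using L2_continuous_linear_tendsto[OF L2_C0_semigroupD(7)[OF S2(1) t] u ev lim] on_dom[OF t v(1)]
        by simp
    ultimately have "l2_embed M (S1 t u) = l2_embed M (S2 t u)" by (rule LIMSEQ_unique)
    then show ?thesis
      using embed_inject[OF L2_C0_semigroupD(1)[OF S1(1) t u] L2_C0_semigroupD(1)[OF S2(1) t u]] by simp
  qed
  have "K1 u = Some v \<longleftrightarrow> K2 u = Some v" for u v
  proof (cases "u \<in> L2 M \<and> v \<in> L2 M")
    case True
    have "((\<lambda>t. (1 / t) *\<^sub>R (l2_embed M (S1 t u) - l2_embed M u)) \<longlongrightarrow> l2_embed M v) (at_right 0)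
      \<longleftrightarrow> ((\<lambda>t. (1 / t) *\<^sub>R (l2_embed M (S2 t u) - l2_embed M u)) \<longlongrightarrow> l2_embed M v) (at_right 0)"
      by (intro filterlim_cong refl) (use eq True in \<open>auto simp: eventually_at_filter\<close>)
    then show ?thesis using True L2_generator_of_iff[OF S1] L2_generator_of_iff[OF S2] by simp
  next
    case False
    then show ?thesis using S1(2) S2(2) by (auto simp: L2_generator_of_def)
  qed
  then show ?thesis by (metis ext option.exhaust)
qed

lemma M_sym_nonempty: "\<exists>L. L \<in> M_sym M L0"
proof -
  obtain c where "approximable_evolution (l2_embed M ` L2 M) (l2_embed M ` dom L0) (embedded_op M L0) c"
    using approximable_evolution_embedded by blast
  then interpret approximable_evolution "l2_embed M ` L2 M" "l2_embed M ` dom L0" "embedded_op M L0" c .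
  note D0 = L2_linear_operatorD[OF L0]
  \<comment> \<open>A component always lies in L2, so \<open>S_in\<close> holds for all
    \<open>t\<close> and \<open>u\<close>, negative times included.\<close>
  define S where "S t u = component (evolution t (l2_embed M u)) M" for t u
  have S_in: "S t u \<in> L2 M" for t u by (simp add: S_def)
  have S_embed: "l2_embed M (S t u) = evolution t (l2_embed M u)" if "0 \<le> t" "u \<in> L2 M" for t u
    unfolding S_def using that by (intro embed_component evolution_in) auto
  have C0: "L2_C0_semigroup M S"
    unfolding L2_C0_semigroup_def
  proof (intro conjI allI impI ballI)
    fix t :: real assume t: "0 \<le> t"
    show "L2_continuous_linear M (S t)"
      unfolding L2_continuous_linear_def
    proof (intro conjI allI impI ballI S_in)
      show "S t (L2_add M u v) = L2_add M (S t u) (S t v)" if "u \<in> L2 M" "v \<in> L2 M" for u v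
        using that t by (simp add: S_def embed_add evolution_add component_plus)
      show "S t (L2_scale M a u) = L2_scale M a (S t u)" if "u \<in> L2 M" for a u
        using that t by (simp add: S_def embed_scale evolution_scale component_scaleR)
      fix u and e :: real assume u: "u \<in> L2 M" and "0 < e"
      \<comment> \<open>By \<open>evolution_norm_le\<close>, applied to the difference,
        \<open>sqrt (growth t)\<close> is a Lipschitz constant of the evolution at time
        \<open>t\<close>.\<close>
      have "L2_dist M (S t v) (S t u) < e" if v: "v \<in> L2 M" "L2_dist M v u < e / sqrt (growth t)" for v
      proof -
        have mem: "l2_embed M v - l2_embed M u \<in> l2_embed M ` L2 M"
          using u v by (intro subspace_diff[OF subspace_H]) auto
        have "L2_dist M (S t v) (S t u) = norm (evolution t (l2_embed M v) - evolution t (l2_embed M u))"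
          using S_embed[OF t] u v S_in by (simp flip: dist_embed)
        also have "\<dots> = norm (evolution t (l2_embed M v - l2_embed M u))"
          using u v t by (simp add: evolution_diff)
        also have "\<dots> \<le> sqrt (growth t) * norm (l2_embed M v - l2_embed M u)"
          using real_le_rsqrt[OF evolution_norm_le[OF t mem]] by (simp add: real_sqrt_mult)
        also have "\<dots> < sqrt (growth t) * (e / sqrt (growth t))"
          using v u growth_pos[of t] by (intro mult_strict_left_mono) (auto simp: dist_embed)
        also have "\<dots> = e" using growth_pos[of t] by simp
        finally show ?thesis .
      qed
      then show "\<exists>d>0. \<forall>v\<in>L2 M. L2_dist M v u < d \<longrightarrow> L2_dist M (S t v) (S t u) < e"
        using \<open>0 < e\<close> growth_pos[of t] by (intro exI[of _ "e / sqrt (growth t)"]) auto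
    qed
  next
    fix u assume u: "u \<in> L2 M"
    show "S 0 u = u" using u by (simp add: S_def evolution_0)
  next
    fix s t :: real and u assume st: "0 \<le> s" "0 \<le> t" "u \<in> L2 M"
    \<comment> \<open>\<open>evolution_semigroup\<close> runs its first summand first, hence the
      order \<open>t + s\<close>.\<close>
    have "evolution (t + s) (l2_embed M u) = evolution s (evolution t (l2_embed M u))"
      using st by (intro evolution_semigroup) auto
    then show "S (s + t) u = S s (S t u)"
      using S_embed[of t u] st by (simp add: S_def[of s] S_def[of "s + t"] add.commute)
  next
    fix u and t :: real assume u: "u \<in> L2 M" and t: "0 \<le> t"
    have "continuous_on {0..t + 1} (\<lambda>s. evolution s (l2_embed M u))"
      using u by (intro evolution_continuous) auto
    then have "((\<lambda>s. evolution s (l2_embed M u)) \<longlongrightarrow> evolution t (l2_embed M u)) (at t within {0..t + 1})"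
      using t by (auto simp: continuous_on_def)
    \<comment> \<open>Continuity is available on bounded intervals; the extra 1 makes the interval a
      neighbourhood of \<open>t\<close> within the half-line.\<close>
    moreover have "at t within {0..t + 1} = at t within {0..}"
      by (rule at_within_nhd[of t "{..<t + 1}"]) auto
    ultimately have "((\<lambda>s. norm (evolution s (l2_embed M u) - evolution t (l2_embed M u)))
      \<longlongrightarrow> 0) (at t within {0..})"
      by (simp add: tendsto_norm_zero_iff LIM_zero)
    then show "((\<lambda>s. L2_dist M (S s u) (S t u)) \<longlongrightarrow> 0) (at t within {0..})"
    proof (rule Lim_transform_eventually)
      show "\<forall>\<^sub>F s in at t within {0..}. norm (evolution s (l2_embed M u) - evolution t (l2_embed M u))
        = L2_dist M (S s u) (S t u)"
        unfolding eventually_at_filter using S_embed[OF _ u] S_in t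
        by (intro always_eventually allI impI) (simp flip: dist_embed)
    qed
  qed
  \<comment> \<open>The generator is built first as a relation, with the limit taken in the sum
    type; uniqueness of limits then makes it a partial map.\<close>
  define gen where "gen u v \<longleftrightarrow> u \<in> L2 M \<and> v \<in> L2 M
    \<and> ((\<lambda>t. (1 / t) *\<^sub>R (l2_embed M (S t u) - l2_embed M u)) \<longlongrightarrow> l2_embed M v) (at_right 0)" for u v
  have gen_unique: "v = w" if "gen u v" "gen u w" for u v w
  proof -
    have "l2_embed M v = l2_embed M w"
      by (rule tendsto_unique[OF trivial_limit_at_right_real
        that[unfolded gen_def, THEN conjunct2, THEN conjunct2]])
    then show ?thesis using that embed_inject[of v M w] by (simp add: gen_def)
  qed
  define L where "L u = (if \<exists>v. gen u v then Some (THE v. gen u v) else None)" for u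
  have L_iff: "L u = Some v \<longleftrightarrow> gen u v" for u v
  proof -
    have "(THE v. gen u v) = v" if "gen u v" for v
      using that by (rule the_equality) (rule gen_unique[OF _ that])
    then show ?thesis by (auto simp: L_def)
  qed
  have L_gen: "L2_generator_of M S L"
    unfolding L2_generator_of_def L_iff gen_def
    by (intro allI conj_cong refl generator_limit_iff[symmetric] S_in)
  have gen_add: "gen (L2_add M u w) (L2_add M v x)" if "gen u v" "gen w x" for u v w x
  proof -
    have in_L2: "u \<in> L2 M" "v \<in> L2 M" "w \<in> L2 M" "x \<in> L2 M" using that by (auto simp: gen_def)
    have "((\<lambda>t. (1 / t) *\<^sub>R (l2_embed M (S t u) - l2_embed M u)
      + (1 / t) *\<^sub>R (l2_embed M (S t w) - l2_embed M w))
        \<longlongrightarrow> l2_embed M v + l2_embed M x) (at_right 0)"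
      using that by (intro tendsto_add) (auto simp: gen_def)
    then have "((\<lambda>t. (1 / t) *\<^sub>R (l2_embed M (S t (L2_add M u w)) - l2_embed M (L2_add M u w)))
        \<longlongrightarrow> l2_embed M (L2_add M v x)) (at_right 0)"
      unfolding embed_add[OF in_L2(2,4)]
      by (rule Lim_transform_eventually)
        (use in_L2 S_in L2_C0_semigroupD(2)[OF C0] in
          \<open>auto simp: eventually_at_filter embed_add scaleR_add_right scaleR_diff_right\<close>)
    then show ?thesis using in_L2 by (simp add: gen_def L2_add_in)
  qed
  have gen_scale: "gen (L2_scale M a u) (L2_scale M a v)" if "gen u v" for a u v
  proof -
    have in_L2: "u \<in> L2 M" "v \<in> L2 M" using that by (auto simp: gen_def)
    have "((\<lambda>t. a *\<^sub>R ((1 / t) *\<^sub>R (l2_embed M (S t u) - l2_embed M u)))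
      \<longlongrightarrow> a *\<^sub>R l2_embed M v) (at_right 0)"
      using that by (intro tendsto_scaleR tendsto_const) (auto simp: gen_def)
    then have "((\<lambda>t. (1 / t) *\<^sub>R (l2_embed M (S t (L2_scale M a u)) - l2_embed M (L2_scale M a u)))
        \<longlongrightarrow> l2_embed M (L2_scale M a v)) (at_right 0)"
      unfolding embed_scale[OF in_L2(2)]
      by (rule Lim_transform_eventually)
        (use in_L2 S_in L2_C0_semigroupD(3)[OF C0] in
          \<open>auto simp: eventually_at_filter embed_scale scaleR_diff_right mult.commute\<close>)
    then show ?thesis using in_L2 by (simp add: gen_def L2_scale_in)
  qed
  have gen_L: "gen u (the (L u))" if "u \<in> dom L" for u
    unfolding L_iff[symmetric] using that by (simp add: domIff)
  have L_eq: "u \<in> dom L" "the (L u) = v" if "gen u v" for u v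
    using that unfolding L_iff[symmetric] by auto
  have gen_L0: "gen u (the (L0 u))" if u: "u \<in> dom L0" for u
  proof -
    have in_L2: "u \<in> L2 M" "the (L0 u) \<in> L2 M" using u D0 by auto
    have "((\<lambda>t. (1 / t) *\<^sub>R (evolution t (l2_embed M u) - l2_embed M u))
      \<longlongrightarrow> l2_embed M (the (L0 u))) (at_right 0)"
      using evolution_derivative[of "l2_embed M u"] u by (simp add: embedded_op_embed[OF L0])
    then have "((\<lambda>t. (1 / t) *\<^sub>R (l2_embed M (S t u) - l2_embed M u))
      \<longlongrightarrow> l2_embed M (the (L0 u))) (at_right 0)"
      by (rule Lim_transform_eventually) (use S_embed in_L2 in \<open>auto simp: eventually_at_filter\<close>)
    then show ?thesis using in_L2 by (simp add: gen_def)
  qed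
  have linear: "L2_linear_operator M L"
    unfolding L2_linear_operator_def L2_subspace_def
  proof (intro conjI ballI allI)
    show "dom L \<subseteq> L2 M" "ran L \<subseteq> L2 M" using L_iff by (auto simp: gen_def ran_def)
    \<comment> \<open>Zero lies in the domain of the linear operator \<open>L0\<close>, and
      \<open>gen_L0\<close> carries it into that of \<open>L\<close>.\<close>
    have "gen (L2_zero M) (the (L0 (L2_zero M)))" using D0(1)
      by (intro gen_L0) (simp add: L2_subspace_def)
    then show "L2_zero M \<in> dom L" by (rule L_eq)
  qed (use gen_add[OF gen_L gen_L] gen_scale[OF gen_L] L_eq in blast)+
  have extends: "Map.graph L0 \<subseteq> Map.graph L"
  proof
    fix p assume "p \<in> Map.graph L0"
    then obtain u v where p: "p = (u, v)" "L0 u = Some v" by (auto simp: Map.graph_def)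
    then have "L u = Some v" using gen_L0[of u] by (auto simp: L_iff)
    then show "p \<in> Map.graph L" using p by (simp add: Map.graph_def)
  qed
  have symmetric: "L2_symmetric M L"
    unfolding L2_symmetric_def
  proof
    fix p assume "p \<in> Map.graph L"
    then obtain v w where p: "p = (v, w)" "gen v w" using L_iff by (auto simp: Map.graph_def)
    \<comment> \<open>Symmetry of the evolution passes to its difference quotients, so a single
      family of pairings has both inner products as its limit.\<close>
    have "L2_inner M (the (L u)) v = L2_inner M u w" if "u \<in> dom L" for u
    proof -
      define x where "x = the (L u)"
      have g: "gen u x" using gen_L[OF that] by (simp add: x_def)
      have in_L2: "u \<in> L2 M" "x \<in> L2 M" "v \<in> L2 M" "w \<in> L2 M" using g p by (auto simp: gen_def)
      have "((\<lambda>t. inner ((1 / t) *\<^sub>R (l2_embed M (S t u) - l2_embed M u)) (l2_embed M v))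
          \<longlongrightarrow> inner (l2_embed M x) (l2_embed M v)) (at_right 0)"
        using g by (intro tendsto_inner tendsto_const) (auto simp: gen_def)
      moreover have "((\<lambda>t. inner ((1 / t) *\<^sub>R (l2_embed M (S t u) - l2_embed M u)) (l2_embed M v))
          \<longlongrightarrow> inner (l2_embed M u) (l2_embed M w)) (at_right 0)"
      proof (rule Lim_transform_eventually)
        show "((\<lambda>t. inner (l2_embed M u) ((1 / t) *\<^sub>R (l2_embed M (S t v) - l2_embed M v)))
          \<longlongrightarrow> inner (l2_embed M u) (l2_embed M w)) (at_right 0)"
          using p by (intro tendsto_inner tendsto_const) (auto simp: gen_def)
        have "inner (evolution t (l2_embed M u)) (l2_embed M v)
          = inner (l2_embed M u) (evolution t (l2_embed M v))"
          if "0 < t" for t using that in_L2 by (intro evolution_sym) auto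
        then show "\<forall>\<^sub>F t in at_right 0. inner (l2_embed M u)
          ((1 / t) *\<^sub>R (l2_embed M (S t v) - l2_embed M v))
            = inner ((1 / t) *\<^sub>R (l2_embed M (S t u) - l2_embed M u)) (l2_embed M v)"
          using S_embed in_L2 by (auto simp: eventually_at_filter inner_diff_left inner_diff_right)
      qed
      ultimately have "inner (l2_embed M x) (l2_embed M v) = inner (l2_embed M u) (l2_embed M w)"
        by (rule tendsto_unique[OF trivial_limit_at_right_real])
      then show ?thesis using in_L2 by (simp add: inner_embed x_def)
    qed
    then show "p \<in> L2_adjoint_graph M L" using p by (auto simp: L2_adjoint_graph_def gen_def)
  qed
  have "L2_generator M L" unfolding L2_generator_def using C0 L_gen by blast
  then show ?thesis using linear extends symmetric by (auto simp: M_sym_def)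
qed

end

theorem proposition2p2:
  fixes M :: "'a measure" and D0 :: "'a l2 set" and L0 :: "'a l2_op"
  assumes "sigma_finite_measure M"
    and "L2_subspace M D0" and "L2_dense M D0"
    and "L2_linear_operator M L0" and "dom L0 = D0"
    and "L2_symmetric M L0"
    and "L2_upper_bounded M L0"
    and "\<And>T. 0 < T \<Longrightarrow> L2_dense (spacetime T M) (L2_span (spacetime T M) (spacetime_image T M L0))"
  shows "\<exists>!L. L \<in> M_sym M L0"
proof (rule ex_ex1I)
  have D: "L2_dense M (dom L0)" using assms(3,5) by simp
  show "\<exists>L. L \<in> M_sym M L0"
    by (rule M_sym_nonempty[OF assms(1) D assms(4,6,7,8)])
  show "L = L'" if "L \<in> M_sym M L0" "L' \<in> M_sym M L0" for L L'
    using M_sym_unique[OF assms(1) D assms(4,6,7,8) that] .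
qed

end
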